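(* Let $n\ge 1$ and let $A,B\in \mathrm{SGL}_n(\mathbb{F}_2)$ be such that $B-A=\sum_{i=1}^{r+1}\mathbf{x}_i\mathbf{x}_i^{\top}$, where $r>0$ is even, $\mathbf{x}_1,\ldots,\mathbf{x}_r\in\mathbb{F}_2^n$ are linearly independent and $\mathbf{x}_{r+1}=\sum_{i=1}^r\mathbf{x}_i$. (i) If the $(r+1)\times(r+1)$ matrix $[\mathbf{x}_i^{\top}A^{-1}\mathbf{x}_j]_{i,j=1}^{r+1}$ is not of rank one, then $d(A,B)=r+1$. (ii) If $[\mathbf{x}_i^{\top}A^{-1}\mathbf{x}_j]_{i,j=1}^{r+1}$ is of rank one, then $d(A,B)=r+2$.
   Context: $\mathbb{F}_2$ is the binary field. $\mathrm{SGL}_n(\mathbb{F}_2)$ is the set of invertible symmetric $n\times n$ matrices over $\mathbb{F}_2$. $\Gamma_n$ is the graph with vertex set $\mathrm{SGL}_n(\mathbb{F}_2)$ in which $A,B$ are adjacent iff $\mathrm{rank}(A-B)=1$; $d(A,B)$ denotes the graph distance in $\Gamma_n$. *)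

theory Defs
  imports "HOL-Library.Z2" "HOL-Library.Extended_Nat" "Jordan_Normal_Form.DL_Rank"
begin

definition SGL :: "nat \<Rightarrow> bit mat set" where
  "SGL n = {A. A \<in> carrier_mat n n \<and> invertible_mat A \<and> transpose_mat A = A}"

definition gamma_adj :: "nat \<Rightarrow> bit mat \<Rightarrow> bit mat \<Rightarrow> bool" where
  "gamma_adj n A B \<longleftrightarrow> A \<in> SGL n \<and> B \<in> SGL n \<and> vec_space.rank n (A - B) = 1"

definition gamma_walk :: "nat \<Rightarrow> nat \<Rightarrow> bit mat \<Rightarrow> bit mat \<Rightarrow> bool" where
  "gamma_walk n k A B \<longleftrightarrow> (\<exists>p :: nat \<Rightarrow> bit mat. p 0 = A \<and> p k = B \<and>
     (\<forall>i\<le>k. p i \<in> SGL n) \<and> (\<forall>i<k. gamma_adj n (p i) (p (Suc i))))"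

text \<open>Graph distance in Gamma_n (infinity if no walk exists).\<close>
definition gamma_dist :: "nat \<Rightarrow> bit mat \<Rightarrow> bit mat \<Rightarrow> enat" where
  "gamma_dist n A B = (INF k \<in> {k. gamma_walk n k A B}. enat k)"

definition lin_indep_vecs :: "nat \<Rightarrow> nat \<Rightarrow> (nat \<Rightarrow> bit vec) \<Rightarrow> bool" where
  "lin_indep_vecs n r x \<longleftrightarrow>
     (\<forall>c :: nat \<Rightarrow> bit. (\<forall>j<n. (\<Sum>i<r. c i * x i $ j) = 0) \<longrightarrow> (\<forall>i<r. c i = 0))"

end

theory Submission
  imports Defs "HOL-Library.Function_Algebras"
begin

text \<open>
  A rank-one symmetric matrix over the binary field is an outer square, so a walk of length \<open>k\<close>
  writes \<open>S = B - A\<close> as a sum of \<open>k\<close> outer squares. Here \<open>S\<close> is alternating of rank \<open>r\<close>, so the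
  \<open>k\<close> vectors sum to zero and their span contains the image \<open>U\<close> of \<open>S\<close>, whence \<open>k \<ge> r + 1\<close>. If \<open>k = r + 1\<close>, all
  vectors lie in \<open>U\<close> and span it; when the form \<open>a\<close> of the inverse of \<open>A\<close> is \<open>f \<otimes> f\<close> on \<open>U\<close>, invertibility
  along the walk forces \<open>f\<close> to vanish on every one of them, so \<open>f = 0\<close>.

  For the constructions, let \<open>s\<close> be the nondegenerate form on \<open>U\<close> induced by \<open>S\<close> and \<open>b = s + a\<close>,
  which is nondegenerate because \<open>B\<close> is invertible. Removing from \<open>B\<close> the outer square of a vector
  \<open>w\<close> with \<open>s w w = 1\<close> replaces \<open>U\<close> by the hyperplane of vectors \<open>s\<close>-orthogonal to \<open>w\<close>, with \<open>s\<close> and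
  \<open>a\<close> restricted. By counting, \<open>w\<close> can be chosen so that \<open>b\<close> stays nondegenerate, \<open>s\<close> and \<open>b\<close> stay
  non-alternating and \<open>a\<close> stays of rank different from one; this gives a walk of length \<open>rank S\<close>
  whenever these conditions hold at the start. An alternating \<open>S\<close> is brought to this situation by
  one extra step, with a vector inside \<open>U\<close> if \<open>a\<close> is not of rank one on \<open>U\<close>, and with a vector
  outside \<open>U\<close>, which raises the rank to \<open>r + 1\<close>, if it is.
\<close>

section \<open>Forms on elementary abelian 2-groups\<close>

(* These rules rewrite field arithmetic on bits into bit operations, out of reach of the ring lemmas. *)
declare add_bit_eq_xor [simp del] mult_bit_eq_and [simp del]

lemma bit_add_self [simp]: "x + x = (0::bit)"
  by (cases x) simp_all

lemma bit_add_eq_0_iff [simp]: "x + y = 0 \<longleftrightarrow> x = (y::bit)"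
  by (cases x; cases y) simp_all

lemma bit_mult_self [simp]: "x * x = (x::bit)"
  by (cases x) simp_all

lemma bit_add_eq_1_iff: "x + y = 1 \<longleftrightarrow> x \<noteq> (y::bit)"
  by (cases x; cases y) simp_all

text \<open>Over the binary field a linear subspace is an additive subgroup of exponent two, so
  scalars do not occur. Finiteness is built in because cardinalities take the place of
  dimensions.\<close>

definition subsp :: "'a::ab_group_add set \<Rightarrow> bool" where
  "subsp U \<longleftrightarrow> finite U \<and> 0 \<in> U \<and> (\<forall>u\<in>U. \<forall>v\<in>U. u + v \<in> U) \<and> (\<forall>u\<in>U. u + u = 0)"

definition lin_on :: "'a::ab_group_add set \<Rightarrow> ('a \<Rightarrow> bit) \<Rightarrow> bool" where
  "lin_on U f \<longleftrightarrow> (\<forall>u\<in>U. \<forall>v\<in>U. f (u + v) = f u + f v)"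

definition sym_form :: "'a::ab_group_add set \<Rightarrow> ('a \<Rightarrow> 'a \<Rightarrow> bit) \<Rightarrow> bool" where
  "sym_form U s \<longleftrightarrow> (\<forall>u\<in>U. lin_on U (s u)) \<and> (\<forall>u\<in>U. \<forall>v\<in>U. s u v = s v u)"

definition nondeg :: "'a::ab_group_add set \<Rightarrow> ('a \<Rightarrow> 'a \<Rightarrow> bit) \<Rightarrow> bool" where
  "nondeg U s \<longleftrightarrow> (\<forall>u\<in>U. (\<forall>v\<in>U. s u v = 0) \<longrightarrow> u = 0)"

text \<open>This is \<open>a = f \<otimes> f\<close> for a nonzero functional \<open>f\<close>: a
  bit equals its square, so \<open>f u = a u u\<close> can be read off the diagonal.\<close>

definition rank_one_on :: "'a::ab_group_add set \<Rightarrow> ('a \<Rightarrow> 'a \<Rightarrow> bit) \<Rightarrow> bool" where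
  "rank_one_on U a \<longleftrightarrow> (\<forall>u\<in>U. \<forall>v\<in>U. a u v = a u u * a v v) \<and> (\<exists>u\<in>U. a u u = 1)"

lemma rank_one_onD: "rank_one_on U a \<Longrightarrow> u \<in> U \<Longrightarrow> v \<in> U \<Longrightarrow> a u v = a u u * a v v"
  unfolding rank_one_on_def by blast

lemma subspD:
  assumes "subsp U"
  shows "finite U" "0 \<in> U" "\<And>u v. u \<in> U \<Longrightarrow> v \<in> U \<Longrightarrow> u + v \<in> U" "\<And>u. u \<in> U \<Longrightarrow> u + u = 0"
  using assms by (auto simp: subsp_def)

lemma subsp_add_eq_0:
  assumes "subsp U" "u \<in> U" "v \<in> U" shows "u + v = 0 \<longleftrightarrow> u = v"
  using subspD(4)[OF assms(1,2)] by (metis add_left_cancel)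

lemma subsp_add_cancel:
  assumes "subsp U" "v \<in> U" shows "u + v + v = u"
  using subspD(4)[OF assms] by (simp add: add.assoc)

lemma lin_onD: "lin_on U f \<Longrightarrow> u \<in> U \<Longrightarrow> v \<in> U \<Longrightarrow> f (u + v) = f u + f v"
  by (simp add: lin_on_def)

lemma lin_on_0: "subsp U \<Longrightarrow> lin_on U f \<Longrightarrow> f 0 = 0"
  using lin_onD[of U f 0 0] subspD(2)[of U] by simp

lemma lin_on_add: "lin_on U f \<Longrightarrow> lin_on U g \<Longrightarrow> lin_on U (\<lambda>u. f u + g u)"
  by (simp add: lin_on_def algebra_simps)

lemma lin_on_mult: "lin_on U f \<Longrightarrow> lin_on U (\<lambda>u. c * f u)"
  by (simp add: lin_on_def algebra_simps)

lemma lin_on_subset: "lin_on U f \<Longrightarrow> V \<subseteq> U \<Longrightarrow> lin_on V f"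
  by (auto simp add: lin_on_def)

lemma subsp_kernel: "subsp U \<Longrightarrow> lin_on U f \<Longrightarrow> subsp {u \<in> U. f u = 0}"
  by (auto simp: subsp_def lin_on_def lin_on_0)

lemma sym_formD:
  assumes "sym_form U s"
  shows "u \<in> U \<Longrightarrow> lin_on U (s u)" "u \<in> U \<Longrightarrow> v \<in> U \<Longrightarrow> s u v = s v u"
  using assms by (auto simp: sym_form_def)

lemma sym_form_add_right:
  "sym_form U s \<Longrightarrow> u \<in> U \<Longrightarrow> v \<in> U \<Longrightarrow> w \<in> U \<Longrightarrow> s u (v + w) = s u v + s u w"
  by (simp add: sym_form_def lin_on_def)

lemma sym_form_add_left:
  "subsp U \<Longrightarrow> sym_form U s \<Longrightarrow> u \<in> U \<Longrightarrow> v \<in> U \<Longrightarrow> w \<in> U \<Longrightarrow> s (u + v) w = s u w + s v w"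
  using sym_form_add_right[of U s w u v] sym_formD(2)[of U s] subspD(3)[of U u v] by simp

lemma sym_form_subset: "sym_form U s \<Longrightarrow> V \<subseteq> U \<Longrightarrow> sym_form V s"
  unfolding sym_form_def by (meson lin_on_subset subsetD)

lemma sym_form_plus: "sym_form U s \<Longrightarrow> sym_form U a \<Longrightarrow> sym_form U (\<lambda>u v. s u v + a u v)"
  by (simp add: sym_form_def lin_on_add)

text \<open>The two cross terms agree by symmetry and cancel in characteristic two. Linearity of the
  diagonal is what provides characteristic vectors, those that represent
  \<open>s u u\<close>.\<close>

lemma sym_form_diag:
  assumes "subsp U" "sym_form U s" shows "lin_on U (\<lambda>u. s u u)"
  unfolding lin_on_def
proof (intro ballI)
  fix u v assume "u \<in> U" "v \<in> U"
  then have "s (u + v) (u + v) = s u u + s v v + (s u v + s v u)"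
    using assms by (simp add: sym_form_add_left sym_form_add_right subspD algebra_simps)
  then show "s (u + v) (u + v) = s u u + s v v"
    using sym_formD(2)[OF assms(2) \<open>u \<in> U\<close> \<open>v \<in> U\<close>] by simp
qed

section \<open>Counting by translations and signs\<close>

lemma bij_translate:
  assumes "subsp U" "u \<in> U" shows "bij_betw (\<lambda>x. x + u) U U"
  by (rule bij_betwI[where g="\<lambda>x. x + u"]) (use assms in \<open>auto simp: subspD subsp_add_cancel\<close>)

definition chi :: "bit \<Rightarrow> int" where "chi b = (if b = 0 then 1 else -1)"

lemma chi_add: "chi (a + b) = chi a * chi b"
  by (cases a; cases b) (simp_all add: chi_def)

text \<open>Translation by \<open>u\<close> permutes \<open>U\<close> and flips every sign, so the
  sum equals its own negative.\<close>

lemma sum_chi_eq_0: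
  assumes "subsp U" "lin_on U f" "u \<in> U" "f u = 1"
  shows "(\<Sum>x\<in>U. chi (f x)) = 0"
proof -
  have "(\<Sum>x\<in>U. chi (f x)) = (\<Sum>x\<in>U. chi (f (x + u)))"
    using sum.reindex_bij_betw[OF bij_translate[OF assms(1,3)], of "\<lambda>x. chi (f x)"] by simp
  also have "\<dots> = (\<Sum>x\<in>U. - chi (f x))"
    using assms by (intro sum.cong) (auto simp: lin_onD chi_add chi_def)
  finally show ?thesis by (simp add: sum_negf)
qed

text \<open>If no element of \<open>Y\<close> represents \<open>\<phi>\<close>, then evaluating the double character sum of
  \<open>\<phi> x + p x y\<close> in both orders gives both \<open>0\<close> and the cardinality of \<open>Y\<close>.\<close>

lemma functional_represented:
  assumes X: "subsp X" and Y: "subsp Y"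
    and p1: "\<And>x. x \<in> X \<Longrightarrow> lin_on Y (p x)" and p2: "\<And>y. y \<in> Y \<Longrightarrow> lin_on X (\<lambda>x. p x y)"
    and nd: "\<And>x. x \<in> X \<Longrightarrow> (\<And>y. y \<in> Y \<Longrightarrow> p x y = 0) \<Longrightarrow> x = 0"
    and phi: "lin_on X \<phi>"
  shows "\<exists>y\<in>Y. \<forall>x\<in>X. p x y = \<phi> x"
proof (rule ccontr)
  assume neg: "\<not> ?thesis"
  have "(\<Sum>x\<in>X. chi (\<phi> x + p x y)) = 0" if "y \<in> Y" for y
  proof -
    obtain u where u: "u \<in> X" "p u y \<noteq> \<phi> u" using neg \<open>y \<in> Y\<close> by blast
    show ?thesis
      by (rule sum_chi_eq_0[OF X lin_on_add[OF phi p2[OF that]] u(1)])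
         (use u(2) in \<open>metis bit_add_eq_1_iff\<close>)
  qed
  then have "(\<Sum>y\<in>Y. \<Sum>x\<in>X. chi (\<phi> x + p x y)) = 0" by simp
  moreover have "(\<Sum>y\<in>Y. \<Sum>x\<in>X. chi (\<phi> x + p x y)) = (\<Sum>x\<in>X. chi (\<phi> x) * (\<Sum>y\<in>Y. chi (p x y)))"
    by (subst sum.swap) (simp add: chi_add sum_distrib_left)
  moreover have "\<dots> = (\<Sum>x\<in>X. if x = 0 then int (card Y) else 0)"
  proof (rule sum.cong, simp)
    fix x assume x: "x \<in> X"
    show "chi (\<phi> x) * (\<Sum>y\<in>Y. chi (p x y)) = (if x = 0 then int (card Y) else 0)"
    proof (cases "x = 0")
      case True
      have "p 0 y = 0" if "y \<in> Y" for y using lin_on_0[OF X p2[OF that]] .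
      moreover have "\<phi> 0 = 0" by (rule lin_on_0[OF X phi])
      ultimately show ?thesis using True by (simp add: chi_def)
    next
      case False
      then obtain y where "y \<in> Y" "p x y \<noteq> 0" using nd x by blast
      then have "(\<Sum>y\<in>Y. chi (p x y)) = 0" by (intro sum_chi_eq_0[OF Y p1[OF x]]) auto
      then show ?thesis using False by simp
    qed
  qed
  moreover have "\<dots> = int (card Y)" using subspD[OF X] by simp
  moreover have "card Y > 0" using subspD[OF Y] card_gt_0_iff by blast
  ultimately show False by linarith
qed

text \<open>Riesz representation: \<open>functional_represented\<close> for the pairing of
  \<open>U\<close> with itself, the symmetry of \<open>s\<close> moving the representing vector to
  the first argument.\<close>

lemma nondeg_represents:
  assumes "subsp U" "sym_form U s" "nondeg U s" "lin_on U f"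
  shows "\<exists>w\<in>U. \<forall>u\<in>U. s w u = f u"
proof -
  have "\<exists>y\<in>U. \<forall>x\<in>U. s x y = f x"
  proof (rule functional_represented[OF assms(1,1)])
    show "lin_on U (\<lambda>x. s x y)" if "y \<in> U" for y
      using assms that unfolding lin_on_def by (simp add: sym_form_add_left)
    show "x = 0" if "x \<in> U" "\<And>y. y \<in> U \<Longrightarrow> s x y = 0" for x
      using assms(3) that by (simp add: nondeg_def)
  qed (use assms in \<open>auto simp: sym_formD\<close>)
  then show ?thesis using sym_formD(2)[OF assms(2)] by metis
qed

lemma nondeg_inj:
  assumes "subsp U" "sym_form U s" "nondeg U s" "x \<in> U" "y \<in> U" "\<And>u. u \<in> U \<Longrightarrow> s x u = s y u"
  shows "x = y"
proof -
  have "\<forall>u\<in>U. s (x + y) u = 0" using assms by (simp add: sym_form_add_left)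
  then have "x + y = 0" using assms(3) subspD(3)[OF assms(1,4,5)] unfolding nondeg_def by blast
  then show ?thesis using subsp_add_eq_0[OF assms(1,4,5)] by simp
qed

lemma sym_form_0_left: "subsp U \<Longrightarrow> sym_form U s \<Longrightarrow> u \<in> U \<Longrightarrow> s 0 u = 0"
  using lin_on_0[of U "s u"] sym_formD[of U s u] sym_formD(2)[of U s u 0] subspD(2)[of U] by simp

lemma card_half:
  assumes "subsp U" "lin_on U f" "u \<in> U" "f u = 1"
  shows "2 * card {x \<in> U. f x = 0} = card U" "2 * card {x \<in> U. f x = 1} = card U"
proof -
  have "bij_betw (\<lambda>x. x + u) {x \<in> U. f x = 0} {x \<in> U. f x = 1}"
    by (rule bij_betwI[where g="\<lambda>x. x + u"])
       (use assms in \<open>auto simp: subspD subsp_add_cancel lin_onD\<close>)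
  then have eq: "card {x \<in> U. f x = 0} = card {x \<in> U. f x = 1}" by (rule bij_betw_same_card)
  have "U = {x \<in> U. f x = 0} \<union> {x \<in> U. f x = 1}" by auto
  then have "card U = card {x \<in> U. f x = 0} + card {x \<in> U. f x = 1}"
    using subspD(1)[OF assms(1)] card_Un_disjoint[of "{x \<in> U. f x = 0}" "{x \<in> U. f x = 1}"] by fastforce
  with eq show "2 * card {x \<in> U. f x = 0} = card U" "2 * card {x \<in> U. f x = 1} = card U" by auto
qed

text \<open>If \<open>g\<close> were neither zero nor \<open>f\<close>, points with
  \<open>g x = 1\<close> and \<open>g y \<noteq> f y\<close> would both have \<open>f\<close>-value
  1, and their sum would lie in the kernel of \<open>f\<close> with \<open>g (x + y) = 1\<close>.
  Mostly applied to find the radical of a form restricted to a hyperplane.\<close>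

lemma functional_vanishing_on_kernel:
  assumes "subsp U" "lin_on U f" "lin_on U g" "\<And>x. x \<in> U \<Longrightarrow> f x = 0 \<Longrightarrow> g x = 0"
  shows "(\<forall>x\<in>U. g x = 0) \<or> (\<forall>x\<in>U. g x = f x)"
proof (rule ccontr)
  assume "\<not> ?thesis"
  then obtain x y where xy: "x \<in> U" "g x = 1" "y \<in> U" "g y \<noteq> f y"
    by auto
  have "f x = 1" using assms(4) xy by fastforce
  moreover have "f y = 1" "g y = 0" using assms(4)[OF xy(3)] xy(4) by (metis bit_not_zero_iff)+
  ultimately have "f (x + y) = 0" "g (x + y) = 1" using xy assms by (auto simp: lin_onD)
  then show False using assms(4)[of "x + y"] xy subspD[OF assms(1)] by auto
qed

section \<open>Parity of the dimension\<close>

text \<open>Induction by splitting off a hyperbolic plane: for \<open>s u v = 1\<close> the vectors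
  orthogonal to both \<open>u\<close> and \<open>v\<close> form a quarter of \<open>U\<close>, and
  the form is again nondegenerate there.\<close>

lemma alternating_card_even:
  assumes "subsp U" "sym_form U s" "nondeg U s" "\<And>u. u \<in> U \<Longrightarrow> s u u = 0" "card U = 2 ^ m"
  shows "even m"
  using assms
proof (induction m arbitrary: U rule: less_induct)
  case (less m)
  note U = less.prems(1) and sf = less.prems(2)
  show ?case
  proof (cases "m = 0")
    case False
    have "card U > 1" using less.prems(5) False one_less_power[of "2::nat" m] by simp
    then have "U \<noteq> {0}" by auto
    then obtain u where u: "u \<in> U" "u \<noteq> 0" using subspD(2)[OF U] by blast
    then obtain v where v: "v \<in> U" "s u v = 1" using less.prems(3) unfolding nondeg_def by (metis bit_not_zero_iff)
    define Y where "Y = {x \<in> U. s u x = 0}"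
    define X where "X = {x \<in> Y. s v x = 0}"
    have Y: "subsp Y" unfolding Y_def using U sf u by (intro subsp_kernel) (auto simp: sym_formD)
    have YU: "Y \<subseteq> U" by (auto simp: Y_def)
    have lv: "lin_on Y (s v)" using sf v YU lin_on_subset sym_formD(1) by blast
    have X: "subsp X" unfolding X_def by (rule subsp_kernel[OF Y lv])
    have uY: "u \<in> Y" "s v u = 1" using u v less.prems by (auto simp: Y_def sym_formD)
    have cY: "2 * card Y = card U" unfolding Y_def
      using card_half(1)[OF U sym_formD(1)[OF sf u(1)] v] .
    have cX: "2 * card X = card Y" unfolding X_def
      using card_half(1)[OF Y lv uY] .
    have "4 * card X = 2 ^ m" using cX cY less.prems(5) by simp
    then obtain k where k: "m = Suc (Suc k)"
      by (cases m; cases "m - 1") auto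
    have "even k"
    proof (rule less.IH)
      show "sym_form X s" using sf X_def YU by (auto intro: sym_form_subset)
      show "nondeg X s" unfolding nondeg_def
      proof (intro ballI impI)
        fix x assume x: "x \<in> X" and perp: "\<forall>v\<in>X. s x v = 0"
        have xU: "x \<in> U" "s u x = 0" "s v x = 0" using x by (auto simp: X_def Y_def)
        have "s x w = 0" if w: "w \<in> U" for w
        proof -
          \<comment> \<open>The corrections that move \<open>w\<close> into \<open>X\<close>: since
            the form is alternating and \<open>s u v = 1\<close>, adding \<open>v\<close> changes
            only the value against \<open>u\<close>, and adding \<open>u\<close> only the value
            against \<open>v\<close>. Both corrections are orthogonal to \<open>x\<close>.\<close>
          define a where "a = (if s u w = 0 then 0 else v)"
          define b where "b = (if s v w = 0 then 0 else u)"
          have ab: "a \<in> U" "b \<in> U" using u v subspD[OF U] by (auto simp: a_def b_def)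
          have z: "s y 0 = 0" if "y \<in> U" for y using lin_on_0[OF U sym_formD(1)[OF sf that]] .
          have "w + a + b \<in> X"
            using w ab u v uY less.prems(4) subspD[OF U]
            by (auto simp: X_def Y_def sym_form_add_right[OF sf] z a_def b_def)
          then have "s x (w + a + b) = 0" using perp by blast
          moreover have "s x a = 0" "s x b = 0"
            using xU u v sym_formD(2)[OF sf] z by (auto simp: a_def b_def)
          ultimately show ?thesis
            using w ab xU subspD[OF U] by (simp add: sym_form_add_right[OF sf])
        qed
        then show "x = 0" using less.prems(3) xU by (auto simp: nondeg_def)
      qed
    qed (use X k \<open>4 * card X = 2 ^ m\<close> less.prems(4) X_def Y_def in auto)
    then show ?thesis using k by simp
  qed simp
qed

text \<open>If \<open>s c c = 1\<close>, the form stays nondegenerate on the hyperplane orthogonal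
  to \<open>c\<close>, and it is alternating there because \<open>s u u = s c u = 0\<close>. That
  hyperplane has odd dimension, against \<open>alternating_card_even\<close>.\<close>

lemma characteristic_vector_isotropic:
  assumes "subsp U" "sym_form U s" "nondeg U s" "card U = 2 ^ m" "even m" "c \<in> U"
    and c: "\<And>u. u \<in> U \<Longrightarrow> s c u = s u u"
  shows "s c c = 0"
proof (rule ccontr)
  assume "s c c \<noteq> 0"
  then have cc: "s c c = 1" by simp
  define F where "F = {u \<in> U. s c u = 0}"
  have lc: "lin_on U (s c)" using assms sym_formD by blast
  have F: "subsp F" unfolding F_def by (rule subsp_kernel[OF assms(1) lc])
  have "2 * card F = 2 ^ m" unfolding F_def
    using card_half(1)[OF assms(1) lc assms(6) cc] assms(4) by simp
  then obtain k where k: "m = Suc k" "card F = 2 ^ k" by (cases m) auto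
  have "nondeg F s" unfolding nondeg_def
  proof (intro ballI impI)
    fix x assume x: "x \<in> F" "\<forall>v\<in>F. s x v = 0"
    then have xU: "x \<in> U" "s c x = 0" by (auto simp: F_def)
    have "(\<forall>v\<in>U. s x v = 0) \<or> (\<forall>v\<in>U. s x v = s c v)"
      using x xU by (intro functional_vanishing_on_kernel[OF assms(1) lc sym_formD(1)[OF assms(2)]]) (auto simp: F_def)
    moreover have "s x c \<noteq> s c c" using xU cc assms(2,6) sym_formD(2) by fastforce
    ultimately show "x = 0" using assms(3,6) xU unfolding nondeg_def by blast
  qed
  moreover have "sym_form F s" using assms(2) by (rule sym_form_subset) (auto simp: F_def)
  moreover have "s u u = 0" if "u \<in> F" for u using that c by (auto simp: F_def)
  ultimately have "even k" using alternating_card_even[OF F] k(2) by blast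
  then show False using k assms(5) by simp
qed

section \<open>Choosing a hyperplane\<close>

lemma separate_functionals:
  assumes "subsp U" "lin_on U f" "lin_on U g" "\<exists>u\<in>U. f u = 1" "\<exists>u\<in>U. f u \<noteq> g u"
  shows "\<exists>u\<in>U. f u = 1 \<and> g u = 0"
proof (rule ccontr)
  assume neg: "\<not> ?thesis"
  have "(\<forall>x\<in>U. f x = 0) \<or> (\<forall>x\<in>U. f x = g x)"
  proof (rule functional_vanishing_on_kernel[OF assms(1,3,2)])
    fix x assume "x \<in> U" "g x = 0"
    then show "f x = 0" using neg bit_not_zero_iff by blast
  qed
  then show False using assms(4,5) by force
qed

lemma subsp_four_elements:
  assumes "subsp U" "card U \<le> 4" "t \<in> U" "t' \<in> U" "t \<noteq> 0" "t' \<noteq> 0" "t \<noteq> t'"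
  shows "U = {0, t, t', t + t'}"
proof -
  have "card {0, t, t', t + t'} = 4"
    using assms subsp_add_eq_0[OF assms(1,3,4)] by auto
  moreover have "{0, t, t', t + t'} \<subseteq> U" using assms subspD[OF assms(1)] by auto
  ultimately show ?thesis using card_seteq[of U "{0, t, t', t + t'}"] subspD[OF assms(1)] assms(2) by simp
qed

text \<open>A rank-one \<open>a\<close> makes the diagonals of \<open>s\<close> and
  \<open>s + a\<close> differ, which yields \<open>t\<close> and \<open>t'\<close> with opposite
  diagonal values; they span \<open>U\<close>. Nondegeneracy then forces both forms to be 1 at
  \<open>(t, t')\<close>, so \<open>a t t' = 0\<close> although \<open>a t t = a t' t' = 1\<close>.
  Hence the rank condition is automatic in dimension at most two.\<close>

lemma not_rank_one_small:
  assumes U: "subsp U" and s: "sym_form U s" and a: "sym_form U a"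
    and nds: "nondeg U s" and ndb: "nondeg U (\<lambda>u v. s u v + a u v)"
    and nas: "\<exists>u\<in>U. s u u = 1" and nab: "\<exists>u\<in>U. s u u + a u u = 1" and card: "card U \<le> 4"
  shows "\<not> rank_one_on U a"
proof
  assume r: "rank_one_on U a"
  let ?b = "\<lambda>u v. s u v + a u v"
  have b: "sym_form U ?b" by (rule sym_form_plus[OF s a])
  have ls: "lin_on U (\<lambda>u. s u u)" and lb: "lin_on U (\<lambda>u. s u u + a u u)"
    using sym_form_diag[OF U s] sym_form_diag[OF U b] by auto
  have ne: "\<exists>u\<in>U. s u u \<noteq> s u u + a u u" 
  proof -
    obtain u where "u \<in> U" "a u u = 1" using r unfolding rank_one_on_def by blast
    then show ?thesis by (intro bexI[of _ u]) auto
  qed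
  obtain t where t: "t \<in> U" "s t t = 1" "s t t + a t t = 0"
    using separate_functionals[OF U ls lb nas ne] by blast
  have "\<exists>u\<in>U. s u u + a u u \<noteq> s u u" using ne by metis
  then obtain t' where t': "t' \<in> U" "s t' t' + a t' t' = 1" "s t' t' = 0"
    using separate_functionals[OF U lb ls nab] by blast
  have z: "s 0 0 = 0" "s 0 0 + a 0 0 = 0" using lin_on_0[OF U ls] lin_on_0[OF U lb] by auto
  have nz: "t \<noteq> 0" "t' \<noteq> 0" "t \<noteq> t'" using t t' z by auto
  have Ueq: "U = {0, t, t', t + t'}" by (rule subsp_four_elements[OF U card t(1) t'(1) nz])
  have tt: "t + t' \<in> U" using subspD[OF U] t t' by auto
  have "s t' t = 1"
  proof (rule ccontr)
    assume "s t' t \<noteq> 1"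
    then have "\<forall>v\<in>U. s t' v = 0" using t t' lin_on_0[OF U sym_formD(1)[OF s t'(1)]]
      by (subst Ueq) (auto simp: sym_form_add_right[OF s])
    then show False using nds t' nz by (auto simp: nondeg_def)
  qed
  moreover have "s t t' + a t t' = 1"
  proof (rule ccontr)
    assume "s t t' + a t t' \<noteq> 1"
    then have "\<forall>v\<in>U. ?b t v = 0" using t t' lin_on_0[OF U sym_formD(1)[OF b t(1)]]
      by (subst Ueq) (auto simp: sym_form_add_right[OF s] sym_form_add_right[OF a])
    then show False using ndb t nz by (auto simp: nondeg_def)
  qed
  ultimately have "a t t' = 0" using sym_formD(2)[OF s t(1) t'(1)] by (cases "a t t'") auto
  moreover have "a t t' = a t t * a t' t'" using rank_one_onD[OF r t(1) t'(1)] .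
  ultimately show False using t t' by simp
qed

text \<open>Each condition on \<open>w\<close> serves one conclusion:
  \<open>s w cs = s w w = 1\<close> keeps \<open>s\<close> nondegenerate, \<open>s w cb = 1\<close>
  keeps \<open>b\<close> nondegenerate, and the last two keep \<open>s\<close> and \<open>b\<close>
  from becoming alternating.\<close>

lemma hyperplane_restriction:
  assumes U: "subsp U" and s: "sym_form U s" and b: "sym_form U b"
    and nds: "nondeg U s" and ndb: "nondeg U b"
    and cs: "cs \<in> U" "\<And>u. u \<in> U \<Longrightarrow> s cs u = s u u"
    and cb: "cb \<in> U" "\<And>u. u \<in> U \<Longrightarrow> b cb u = b u u" and nab: "\<exists>u\<in>U. b u u = 1"
    and w: "w \<in> U" "s w cs = 1" "s w cb = 1" "w \<noteq> cs" "\<exists>u\<in>U. s w u \<noteq> b u u"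
  defines "F \<equiv> {u \<in> U. s w u = 0}"
  shows "s w w = 1" "nondeg F s" "nondeg F b" "\<exists>u\<in>F. s u u = 1" "\<exists>u\<in>F. b u u = 1"
proof -
  have lw: "lin_on U (s w)" using sym_formD[OF s] w by blast
  show ww: "s w w = 1" using cs w sym_formD(2)[OF s] by metis
  show "nondeg F s" unfolding nondeg_def
  proof (intro ballI impI)
    fix x assume x: "x \<in> F" "\<forall>v\<in>F. s x v = 0"
    then have xU: "x \<in> U" "s w x = 0" by (auto simp: F_def)
    have "(\<forall>v\<in>U. s x v = 0) \<or> (\<forall>v\<in>U. s x v = s w v)"
      using x xU by (intro functional_vanishing_on_kernel[OF U lw sym_formD(1)[OF s]]) (auto simp: F_def)
    moreover have "s x w \<noteq> s w w" using xU ww sym_formD(2)[OF s] w(1) by (metis zero_neq_one)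
    ultimately show "x = 0" using nds xU w(1) unfolding nondeg_def by blast
  qed
  show "nondeg F b" unfolding nondeg_def
  proof (intro ballI impI)
    fix x assume x: "x \<in> F" "\<forall>v\<in>F. b x v = 0"
    then have xU: "x \<in> U" "s w x = 0" by (auto simp: F_def)
    have "(\<forall>v\<in>U. b x v = 0) \<or> (\<forall>v\<in>U. b x v = s w v)"
      using x xU by (intro functional_vanishing_on_kernel[OF U lw sym_formD(1)[OF b]]) (auto simp: F_def)
    \<comment> \<open>Such an \<open>x\<close> has \<open>b x x = s w x = 0\<close> because it lies
      in \<open>F\<close>, but also \<open>b x x = b x cb = s w cb = 1\<close>.\<close>
    moreover have False if e: "\<forall>v\<in>U. b x v = s w v"
    proof -
      have "b x x = b x cb" using cb xU sym_formD(2)[OF b] by metis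
      then show False using e xU cb w by auto
    qed
    ultimately show "x = 0" using ndb xU unfolding nondeg_def by blast
  qed
  show "\<exists>u\<in>F. s u u = 1"
  proof (rule ccontr)
    assume neg: "\<not> ?thesis"
    have "(\<forall>v\<in>U. s cs v = 0) \<or> (\<forall>v\<in>U. s cs v = s w v)"
    proof (rule functional_vanishing_on_kernel[OF U lw sym_formD(1)[OF s cs(1)]])
      fix x assume "x \<in> U" "s w x = 0"
      then have "s x x \<noteq> 1" using neg by (auto simp: F_def)
      then show "s cs x = 0" using cs \<open>x \<in> U\<close> by simp
    qed
    moreover have "s cs w = 1" using w cs sym_formD(2)[OF s] by metis
    ultimately have e: "\<forall>v\<in>U. s cs v = s w v" using w by fastforce
    have "s (cs + w) v = 0" if "v \<in> U" for v
      using e that w cs by (simp add: sym_form_add_left[OF U s])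
    then have "cs + w = 0" using nds subspD(3)[OF U cs(1) w(1)] by (auto simp: nondeg_def)
    then show False using subsp_add_eq_0[OF U cs(1) w(1)] w by auto
  qed
  show "\<exists>u\<in>F. b u u = 1"
  proof (rule ccontr)
    assume neg: "\<not> ?thesis"
    have "(\<forall>v\<in>U. b v v = 0) \<or> (\<forall>v\<in>U. b v v = s w v)"
    proof (rule functional_vanishing_on_kernel[OF U lw sym_form_diag[OF U b]])
      fix x assume "x \<in> U" "s w x = 0"
      then have "b x x \<noteq> 1" using neg by (auto simp: F_def)
      then show "b x x = 0" by simp
    qed
    then show False using nab w(5) by force
  qed
qed

text \<open>Halve twice: first to the subspace \<open>K\<close> where \<open>f\<close> and
  \<open>g\<close> agree, then to the part of \<open>K\<close> where \<open>f\<close> is 1.\<close>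

lemma card_two_functionals:
  assumes U: "subsp U" and f: "lin_on U f" and g: "lin_on U g"
    and nf: "\<exists>u\<in>U. f u = 1" and ng: "\<exists>u\<in>U. g u = 1" and ne: "\<exists>u\<in>U. f u \<noteq> g u"
  shows "4 * card {u \<in> U. f u = 1 \<and> g u = 1} = card U"
proof -
  define K where "K = {u \<in> U. f u + g u = 0}"
  have l: "lin_on U (\<lambda>u. f u + g u)" by (rule lin_on_add[OF f g])
  have K: "subsp K" unfolding K_def by (rule subsp_kernel[OF U l])
  obtain u where "u \<in> U" "f u + g u = 1" using ne bit_add_eq_1_iff by blast
  then have cK: "2 * card K = card U" unfolding K_def using card_half(1)[OF U l] by blast
  have "\<exists>u\<in>K. f u = 1"
  proof (rule ccontr)
    assume neg: "\<not> ?thesis"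
    have "(\<forall>x\<in>U. f x = 0) \<or> (\<forall>x\<in>U. f x = f x + g x)"
      by (rule functional_vanishing_on_kernel[OF U l f]) (use neg in \<open>auto simp: K_def\<close>)
    then show False using nf ng by force
  qed
  then obtain v where "v \<in> K" "f v = 1" by blast
  moreover have "lin_on K f" using f by (rule lin_on_subset) (auto simp: K_def)
  ultimately have "2 * card {x \<in> K. f x = 1} = card K" using card_half(2)[OF K] by blast
  moreover have "{x \<in> K. f x = 1} = {u \<in> U. f u = 1 \<and> g u = 1}" by (auto simp: K_def)
  ultimately show ?thesis using cK by simp
qed

text \<open>The form \<open>q\<close> with \<open>q u v = a u v + a u u * a v v\<close> is alternating and vanishes on a subspace
  iff \<open>a\<close> has rank at most one there; an alternating form that vanishes on a hyperplane
  has rank at most two, which leaves at most three such hyperplanes.\<close>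

lemma rank_one_hyperplane:
  assumes U: "subsp U" and a: "sym_form U a" and f: "lin_on U f"
    and q: "u \<in> U" "v \<in> U" "a u v \<noteq> a u u * a v v"
    and r: "rank_one_on {x \<in> U. f x = 0} a"
  shows "\<exists>z\<in>{u, v, u + v}. \<forall>x\<in>U. f x = a z x + a z z * a x x"
proof -
  define q where "q u v = a u v + a u u * a v v" for u v
  have da: "lin_on U (\<lambda>x. a x x)" by (rule sym_form_diag[OF U a])
  have lq: "lin_on U (q z)" if "z \<in> U" for z
    unfolding q_def by (intro lin_on_add lin_on_mult sym_formD(1)[OF a that] da)
  have quv: "q u v = 1" "q v u = 1"
    using q bit_add_eq_1_iff sym_formD(2)[OF a q(1,2)] by (auto simp: q_def mult.commute)
  have uv: "u + v \<in> U" using subspD[OF U] q by auto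
  have "q (u + v) v = 1"
    using quv q by (simp add: q_def sym_form_add_left[OF U a] lin_onD[OF da] algebra_simps)
  then have nz: "\<exists>x\<in>U. q z x = 1" if "z \<in> {u, v, u + v}" for z
    using that quv q uv by auto
  \<comment> \<open>By additivity \<open>f\<close> cannot be 1 at \<open>u\<close>, \<open>v\<close>
    and \<open>u + v\<close> at once.\<close>
  have "\<exists>z\<in>{u, v, u + v}. f z = 0"
    using lin_onD[OF f q(1,2)] by (cases "f u"; cases "f v") auto
  then obtain z where z: "z \<in> {u, v, u + v}" "f z = 0" by blast
  have zU: "z \<in> U" using z q uv by auto
  have "(\<forall>x\<in>U. q z x = 0) \<or> (\<forall>x\<in>U. q z x = f x)"
  proof (rule functional_vanishing_on_kernel[OF U f lq[OF zU]])
    fix x assume "x \<in> U" "f x = 0"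
    then have "a z x = a z z * a x x" using rank_one_onD[OF r] z zU by blast
    then show "q z x = 0" unfolding q_def by (simp only: bit_add_eq_0_iff)
  qed
  then have "\<forall>x\<in>U. f x = q z x" using nz[OF z(1)] by force
  then show ?thesis using z unfolding q_def by blast
qed

text \<open>By nondegeneracy distinct nonzero vectors give distinct nonzero functionals, so the set
  is cut out by one or two independent affine equations.\<close>

lemma card_admissible:
  assumes U: "subsp U" and s: "sym_form U s" and nds: "nondeg U s"
    and c: "c \<in> U" "c \<noteq> 0" and d: "d \<in> U" "d \<noteq> 0"
  shows "4 * card {w \<in> U. s w c = 1 \<and> s w d = 1} \<ge> card U"
    and "c = d \<Longrightarrow> 2 * card {w \<in> U. s w c = 1 \<and> s w d = 1} = card U"
    and "c \<noteq> d \<Longrightarrow> 4 * card {w \<in> U. s w c = 1 \<and> s w d = 1} = card U"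
proof -
  have eq: "{w \<in> U. s w c = 1 \<and> s w d = 1} = {w \<in> U. s c w = 1 \<and> s d w = 1}"
    using sym_formD(2)[OF s] c d by auto
  have nz: "\<exists>u\<in>U. s e u = 1" if "e \<in> U" "e \<noteq> 0" for e
    using nds that bit_not_zero_iff unfolding nondeg_def by blast
  show 1: "2 * card {w \<in> U. s w c = 1 \<and> s w d = 1} = card U" if "c = d"
    using card_half(2)[OF U sym_formD(1)[OF s d(1)]] nz[OF d] that unfolding eq by auto
  show 2: "4 * card {w \<in> U. s w c = 1 \<and> s w d = 1} = card U" if ne: "c \<noteq> d"
  proof -
    have "c + d \<in> U" "c + d \<noteq> 0" using subspD[OF U] c d subsp_add_eq_0[OF U c(1) d(1)] ne by auto
    then obtain x where "x \<in> U" "s (c + d) x = 1" using nz by blast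
    then have "s c x \<noteq> s d x" using sym_form_add_left[OF U s c(1) d(1)] by auto
    then show ?thesis unfolding eq using \<open>x \<in> U\<close>
      by (intro card_two_functionals[OF U sym_formD(1)[OF s c(1)] sym_formD(1)[OF s d(1)] nz[OF c] nz[OF d]]) blast
  qed
  show "4 * card {w \<in> U. s w c = 1 \<and> s w d = 1} \<ge> card U"
    using 1 2 by (cases "c = d") auto
qed

lemma obtain_outside:
  assumes "finite X" "card X < card Y" shows "\<exists>y\<in>Y. y \<notin> X"
  using assms by (metis card_mono not_le subsetI)

text \<open>Counting guarantees only two admissible vectors, which might be exactly
  \<open>cs\<close> and \<open>d\<close>. In that case \<open>cs\<close> and \<open>cb\<close> lie
  in the radical of \<open>a\<close>, and \<open>a\<close> would have rank one.\<close>

lemma choose_in_dimension_three: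
  assumes U: "subsp U" and s: "sym_form U s" and a: "sym_form U a"
    and nds: "nondeg U s" and ndb: "nondeg U (\<lambda>u v. s u v + a u v)"
    and cs: "cs \<in> U" "cs \<noteq> 0" "\<And>u. u \<in> U \<Longrightarrow> s cs u = s u u"
    and cb: "cb \<in> U" "cb \<noteq> 0" "\<And>u. u \<in> U \<Longrightarrow> s cb u + a cb u = s u u + a u u"
    and d: "d \<in> U" "\<And>u. u \<in> U \<Longrightarrow> s d u = s u u + a u u"
    and nr: "\<not> rank_one_on U a" and card: "card U = 8"
  shows "\<exists>w\<in>U. s w cs = 1 \<and> s w cb = 1 \<and> w \<noteq> cs \<and> w \<noteq> d"
proof (rule ccontr)
  define W where "W = {w \<in> U. s w cs = 1 \<and> s w cb = 1}"
  let ?b = "\<lambda>u v. s u v + a u v"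
  have b: "sym_form U ?b" by (rule sym_form_plus[OF s a])
  assume "\<not> ?thesis"
  then have sub: "W \<subseteq> {cs, d}" by (auto simp: W_def)
  have cW: "card W \<le> 2" using card_mono[OF _ sub] card_insert_le_m1[of 2 "{d}" cs] by fastforce
  have ne: "cs \<noteq> cb"
    using card_admissible(2)[OF U s nds cs(1,2) cb(1,2)] card cW unfolding W_def by auto
  have "card W = 2"
    using card_admissible(3)[OF U s nds cs(1,2) cb(1,2) ne] card unfolding W_def by auto
  then have Weq: "W = {cs, d}" "cs \<noteq> d"
    using card_seteq[OF _ sub] card_2_iff sub by (auto simp: card_insert_if split: if_splits)
  have csW: "s cs cs = 1" "s cs cb = 1" and dW: "s d cs = 1" "s d cb = 1"
    using Weq by (auto simp: W_def)
  have "s cb cs = 1" using csW(2) sym_formD(2)[OF s cs(1) cb(1)] by simp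
  moreover have "s cb cb = 1" using csW(2) cs(3)[OF cb(1)] by simp
  ultimately have "cb \<in> W" using cb(1) by (simp add: W_def)
  then have cbd: "cb = d" using Weq ne by auto
  have a1: "a cb u = 0" if "u \<in> U" for u using cb(3)[OF that] d(2)[OF that] cbd by (cases "a cb u") auto
  have a2: "a cs u = 0" if "u \<in> U" for u
  proof -
    \<comment> \<open>The functional of \<open>cs\<close> under \<open>s + a\<close>. Its
      \<open>s\<close>-representative \<open>e\<close> lies in \<open>W\<close>, so it is
      \<open>cs\<close> or \<open>d\<close>; the latter would give \<open>cs = cb\<close> by
      nondegeneracy of \<open>s + a\<close>. Hence \<open>e = cs\<close>, which says that
      \<open>a cs\<close> vanishes.\<close>
    define f where "f u = s cs u + a cs u" for u
    have "lin_on U f" unfolding f_def by (rule sym_formD(1)[OF b cs(1)])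
    then obtain e where e: "e \<in> U" "\<forall>u\<in>U. s e u = f u" using nondeg_represents[OF U s nds] by blast
    have "f cs = 1"
      using d(2)[OF cs(1)] dW by (simp add: f_def)
    moreover have "f cb = 1" using csW a1[OF cs(1)] sym_formD(2)[OF a cs(1) cb(1)] by (simp add: f_def)
    ultimately have "e \<in> W" using e cs cb by (simp add: W_def)
    moreover have "e \<noteq> d"
    proof
      assume "e = d"
      have "\<forall>u\<in>U. ?b (cs + cb) u = 0"
      proof
        fix u assume u: "u \<in> U"
        have "?b (cs + cb) u = ?b cs u + ?b cb u"
          by (rule sym_form_add_left[OF U b cs(1) cb(1) u])
        also have "\<dots> = 0" using e u d(2)[OF u] cb(3)[OF u] \<open>e = d\<close> by (auto simp: f_def)
        finally show "?b (cs + cb) u = 0" .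
      qed
      then have "cs + cb = 0" using ndb subspD(3)[OF U cs(1) cb(1)] unfolding nondeg_def by blast
      then show False using subsp_add_eq_0[OF U cs(1) cb(1)] ne by simp
    qed
    ultimately have "e = cs" using Weq by auto
    then have "s cs u = s cs u + a cs u" using e that by (auto simp: f_def)
    then show ?thesis by simp
  qed
  \<comment> \<open>The kernel of the diagonal of \<open>a\<close> is spanned by \<open>cs\<close>
    and \<open>cb\<close>, so this hyperplane lies in the radical and \<open>a\<close> is the square
    of its diagonal functional.\<close>
  define K where "K = {u \<in> U. a u u = 0}"
  have da: "lin_on U (\<lambda>u. a u u)" by (rule sym_form_diag[OF U a])
  have na: "\<exists>u\<in>U. a u u = 1"
  proof (rule ccontr)
    assume "\<not> ?thesis"
    then have "\<And>u. u \<in> U \<Longrightarrow> a u u = 0" by auto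
    then have "cs = d" using d cs by (intro nondeg_inj[OF U s nds]) auto
    then show False using Weq by simp
  qed
  then have "card K = 4" using card_half(1)[OF U da] card unfolding K_def by auto
  then have Keq: "K = {0, cs, cb, cs + cb}"
    using a1[OF cb(1)] a2[OF cs(1)] cs cb ne
    by (intro subsp_four_elements) (auto simp: K_def intro: subsp_kernel[OF U da])
  have aK: "a k u = 0" if "k \<in> K" "u \<in> U" for k u
  proof -
    have "a 0 u = 0"
      using lin_on_0[OF U sym_formD(1)[OF a that(2)]] sym_formD(2)[OF a subspD(2)[OF U] that(2)] by simp
    then show ?thesis
      using that(1) a1[OF that(2)] a2[OF that(2)] sym_form_add_left[OF U a cs(1) cb(1) that(2)]
      unfolding Keq by auto
  qed
  have av: "a u v = a u u * a v v" if u: "u \<in> U" and v: "v \<in> U" for u v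
  proof (cases "u \<in> K \<or> v \<in> K")
    case True
    then have "a u v = 0" "a u u = 0 \<or> a v v = 0" using aK u v sym_formD(2)[OF a u v] by auto
    then show ?thesis by auto
  next
    case False
    then have 1: "a u u = 1" "a v v = 1" using u v by (auto simp: K_def)
    then have "u + v \<in> K" using lin_onD[OF da u v] subspD(3)[OF U u v] by (simp add: K_def)
    then have "a u v + a v v = 0" using aK v sym_form_add_left[OF U a u v v] by metis
    then show ?thesis using 1 by simp
  qed
  show False using nr av na unfolding rank_one_on_def by blast
qed

text \<open>The vectors of \<open>W\<close> other than \<open>cs\<close> and \<open>d\<close> meet
  all conditions except the one on the rank of \<open>a\<close>, which excludes at most three more.
  Counting \<open>W\<close> suffices in large dimension; small ones use
  \<open>not_rank_one_small\<close> and the isotropy of characteristic vectors.\<close>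

lemma choose_hyperplane:
  assumes U: "subsp U" and s: "sym_form U s" and a: "sym_form U a"
    and nds: "nondeg U s" and ndb: "nondeg U (\<lambda>u v. s u v + a u v)"
    and nas: "\<exists>u\<in>U. s u u = 1" and nab: "\<exists>u\<in>U. s u u + a u u = 1"
    and nr: "\<not> rank_one_on U a" and card: "card U = 2 ^ m" and m: "m \<ge> 2"
  shows "\<exists>w\<in>U. s w w = 1 \<and> nondeg {u \<in> U. s w u = 0} (\<lambda>u v. s u v + a u v)
    \<and> (\<exists>u\<in>{u \<in> U. s w u = 0}. s u u = 1) \<and> (\<exists>u\<in>{u \<in> U. s w u = 0}. s u u + a u u = 1)
    \<and> \<not> rank_one_on {u \<in> U. s w u = 0} a"
proof -
  let ?b = "\<lambda>u v. s u v + a u v"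
  have b: "sym_form U ?b" by (rule sym_form_plus[OF s a])
  have ds: "lin_on U (\<lambda>u. s u u)" and db: "lin_on U (\<lambda>u. s u u + a u u)"
    using sym_form_diag[OF U s] sym_form_diag[OF U b] by auto
  obtain cs where cs: "cs \<in> U" "\<And>u. u \<in> U \<Longrightarrow> s cs u = s u u"
    using nondeg_represents[OF U s nds ds] by blast
  obtain cb where cb: "cb \<in> U" "\<And>u. u \<in> U \<Longrightarrow> s cb u + a cb u = s u u + a u u"
    using nondeg_represents[OF U b ndb db] by blast
  obtain d where d: "d \<in> U" "\<And>u. u \<in> U \<Longrightarrow> s d u = s u u + a u u"
    using nondeg_represents[OF U s nds db] by blast
  have cs0: "cs \<noteq> 0" using nas cs sym_form_0_left[OF U s] by fastforce
  have cb0: "cb \<noteq> 0" using nab cb sym_form_0_left[OF U b] by fastforce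
  define W where "W = {w \<in> U. s w cs = 1 \<and> s w cb = 1}"
  have W4: "4 * card W \<ge> 2 ^ m"
    using card_admissible(1)[OF U s nds cs(1) cs0 cb(1) cb0] card by (simp add: W_def)
  \<comment> \<open>Since \<open>d\<close> represents the diagonal of \<open>s + a\<close> under
    \<open>s\<close>, the value \<open>s d cb\<close> is that diagonal at \<open>cb\<close>, which
    vanishes in even dimension.\<close>
  have cs_notin: "cs \<notin> W" and d_notin: "d \<notin> W" if "even m"
    using characteristic_vector_isotropic[OF U s nds card that cs]
      characteristic_vector_isotropic[OF U b ndb card that cb] d(2)[OF cb(1)] by (auto simp: W_def)
  have main: ?thesis
    if w: "w \<in> W" "w \<noteq> cs" "w \<noteq> d" and nrF: "m \<le> 3 \<or> \<not> rank_one_on {u \<in> U. s w u = 0} a" for w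
  proof -
    define F where "F = {u \<in> U. s w u = 0}"
    have wU: "w \<in> U" "s w cs = 1" "s w cb = 1" using w by (auto simp: W_def)
    have "\<exists>u\<in>U. s w u \<noteq> s u u + a u u"
      using nondeg_inj[OF U s nds wU(1) d(1)] d w(3) by metis
    note F = hyperplane_restriction[where b="?b", OF U s b nds ndb cs cb nab wU w(2) this, folded F_def]
    have FU: "F \<subseteq> U" by (auto simp: F_def)
    have "\<not> rank_one_on F a"
    proof (cases "m \<le> 3")
      case True
      have "2 * card F = 2 ^ m"
        using card_half(1)[OF U sym_formD(1)[OF s wU(1)] wU(1) F(1)] card by (simp add: F_def)
      moreover have "(2::nat) ^ m \<le> 2 ^ 3" using True by (intro power_increasing) auto
      ultimately have "card F \<le> 4" by simp
      moreover have "subsp F" unfolding F_def by (rule subsp_kernel[OF U sym_formD(1)[OF s wU(1)]])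
      ultimately show ?thesis
        using not_rank_one_small[OF _ sym_form_subset[OF s FU] sym_form_subset[OF a FU] F(2-5)] by blast
    qed (use nrF F_def in simp)
    then show ?thesis using F wU unfolding F_def by blast
  qed
  show ?thesis
  proof (cases "\<forall>u\<in>U. \<forall>v\<in>U. a u v = a u u * a v v")
    case True
    \<comment> \<open>Product form without rank one leaves only \<open>a = 0\<close>. Then both
      forms agree, \<open>cs\<close>, \<open>cb\<close> and \<open>d\<close> coincide, and a single
      vector has to be avoided.\<close>
    then have diag: "a u u = 0" if "u \<in> U" for u
      using nr that bit_not_zero_iff unfolding rank_one_on_def by blast
    then have a0: "a u v = 0" if "u \<in> U" "v \<in> U" for u v
      using True that by (metis mult_zero_left)
    have "d = cs" by (rule nondeg_inj[OF U s nds d(1) cs(1)]) (simp add: d cs diag)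
    moreover have "cb = cs" by (rule nondeg_inj[OF U s nds cb(1) cs(1)]) (use cb cs a0 in auto)
    ultimately have "2 * card W = 2 ^ m"
      using card_admissible(2)[OF U s nds cs(1) cs0 cb(1) cb0] card by (simp add: W_def)
    moreover have "(2::nat) ^ 2 \<le> 2 ^ m" using m by (intro power_increasing) auto
    ultimately have "card {cs} < card W" by simp
    then obtain w where "w \<in> W" "w \<noteq> cs" using obtain_outside[of "{cs}" W] by auto
    moreover have "\<not> rank_one_on {u \<in> U. s w u = 0} a"
      using diag unfolding rank_one_on_def by fastforce
    ultimately show ?thesis using main \<open>d = cs\<close> by blast
  next
    case False
    then obtain u0 v0 where uv: "u0 \<in> U" "v0 \<in> U" "a u0 v0 \<noteq> a u0 u0 * a v0 v0" by blast
    have "\<exists>e\<in>U. \<forall>x\<in>U. s e x = a z x + a z z * a x x" if "z \<in> U" for z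
      by (rule nondeg_represents[OF U s nds])
         (intro lin_on_add lin_on_mult sym_formD(1)[OF a that] sym_form_diag[OF U a])
    then obtain e where e: "\<And>z. z \<in> U \<Longrightarrow> e z \<in> U"
      "\<And>z x. z \<in> U \<Longrightarrow> x \<in> U \<Longrightarrow> s (e z) x = a z x + a z z * a x x" by metis
    \<comment> \<open>By \<open>rank_one_hyperplane\<close>, only these vectors can have an
      orthogonal hyperplane on which \<open>a\<close> is of rank one.\<close>
    define E where "E = {e u0, e v0, e (u0 + v0)}"
    have E: "finite E" "card E \<le> 3" by (auto simp: E_def card_insert_if)
    have good: "\<not> rank_one_on {u \<in> U. s w u = 0} a" if w: "w \<in> W" "w \<notin> E" for w
    proof
      assume r: "rank_one_on {u \<in> U. s w u = 0} a"
      have wU: "w \<in> U" using w by (simp add: W_def)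
      obtain z where z: "z \<in> {u0, v0, u0 + v0}" "\<forall>x\<in>U. s w x = a z x + a z z * a x x"
        using rank_one_hyperplane[OF U a sym_formD(1)[OF s wU] uv r] by blast
      have zU: "z \<in> U" using z uv subspD[OF U] by auto
      have "w = e z" using z(2) e zU by (intro nondeg_inj[OF U s nds wU]) auto
      then show False using w z by (auto simp: E_def)
    qed
    \<comment> \<open>\<open>W\<close> has at least one, two, four or eight elements, and zero, two,
      three or at most five are to be avoided. Only dimension three needs more than
      counting.\<close>
    consider "m = 2" | "m = 3" | "m = 4" | "m \<ge> 5" using m by linarith
    then show ?thesis
    proof cases
      case 1
      then have "card W \<noteq> 0" using W4 by auto
      then obtain w where "w \<in> W" by fastforce
      then show ?thesis using main[of w] cs_notin d_notin 1 by auto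
    next
      case 2
      then obtain w where "w \<in> U" "s w cs = 1" "s w cb = 1" "w \<noteq> cs" "w \<noteq> d"
        using choose_in_dimension_three[OF U s a nds ndb cs(1) cs0 cs(2) cb(1) cb0 cb(2) d nr] card by auto
      then show ?thesis using main[of w] 2 by (auto simp: W_def)
    next
      case 3
      then have "card E < card W" using W4 E by auto
      then obtain w where "w \<in> W" "w \<notin> E" using obtain_outside[OF E(1)] by blast
      then show ?thesis using main[of w] good[of w] cs_notin d_notin 3 by auto
    next
      case 4
      have "(2::nat) ^ 5 \<le> 2 ^ m" using 4 by (intro power_increasing) auto
      then have "card W \<ge> 8" using W4 by simp
      moreover have "card (insert cs (insert d E)) \<le> 5" using E by (auto simp: card_insert_if)
      ultimately obtain w where "w \<in> W" "w \<notin> insert cs (insert d E)"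
        using obtain_outside[of "insert cs (insert d E)" W] E by auto
      then show ?thesis using main[of w] good[of w] by blast
    qed
  qed
qed

section \<open>Symmetric matrices over the binary field\<close>

text \<open>Vectors of length \<open>n\<close> are functions vanishing from \<open>n\<close> on, so
  that they form a subgroup of a type with pointwise addition, as \<open>subsp\<close>
  requires.\<close>

definition bvecs :: "nat \<Rightarrow> (nat \<Rightarrow> bit) set" where
  "bvecs n = {v. \<forall>j\<ge>n. v j = 0}"

definition dot :: "nat \<Rightarrow> (nat \<Rightarrow> bit) \<Rightarrow> (nat \<Rightarrow> bit) \<Rightarrow> bit" where
  "dot n u v = (\<Sum>j<n. u j * v j)"

definition scal :: "bit \<Rightarrow> (nat \<Rightarrow> bit) \<Rightarrow> nat \<Rightarrow> bit" where
  "scal c v = (\<lambda>j. c * v j)"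

definition mv :: "nat \<Rightarrow> bit mat \<Rightarrow> (nat \<Rightarrow> bit) \<Rightarrow> nat \<Rightarrow> bit" where
  "mv n M v = (\<lambda>i. if i < n then \<Sum>j<n. M $$ (i, j) * v j else 0)"

definition outer :: "nat \<Rightarrow> (nat \<Rightarrow> bit) \<Rightarrow> bit mat" where
  "outer n y = mat n n (\<lambda>(i, j). y i * y j)"

lemma scal_simps [simp]: "scal 0 v = 0" "scal 1 v = v" "scal c 0 = 0"
  by (auto simp: scal_def fun_eq_iff)

lemma bij_betw_bvecs: "bij_betw (\<lambda>S j. of_bool (j \<in> S)) (Pow {..<n}) (bvecs n)"
proof (rule bij_betwI[where g="\<lambda>v. {j. v j = 1}"])
  show "(\<lambda>v. {j. v j = 1}) \<in> bvecs n \<rightarrow> Pow {..<n}"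
  proof (safe)
    fix v :: "nat \<Rightarrow> bit" and j assume "v \<in> bvecs n" "v j = 1"
    then show "j < n" by (cases "j < n") (auto simp: bvecs_def)
  qed
  show "(\<lambda>j. of_bool (j \<in> {j. v j = 1})) = v" for v :: "nat \<Rightarrow> bit"
  proof
    fix j show "of_bool (j \<in> {j. v j = 1}) = v j" by (cases "v j") auto
  qed
qed (auto simp: bvecs_def)

lemma card_bvecs: "card (bvecs n) = 2 ^ n"
  using bij_betw_same_card[OF bij_betw_bvecs[of n]] by (simp add: card_Pow)

lemma subsp_bvecs: "subsp (bvecs n)"
  unfolding subsp_def
  using bij_betw_finite[OF bij_betw_bvecs[of n]] by (auto simp: bvecs_def fun_eq_iff)

lemmas bvecs_closed [simp, intro] = subspD(2,3)[OF subsp_bvecs]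

lemma vec_add_self [simp]: "v + v = (0 :: nat \<Rightarrow> bit)"
  by (simp add: fun_eq_iff)

lemma vec_add_self_left [simp]: "v + (v + w) = (w :: nat \<Rightarrow> bit)"
  by (simp flip: add.assoc)

lemma vec_add_eq_0_iff: "u + v = 0 \<longleftrightarrow> u = (v :: nat \<Rightarrow> bit)"
  by (simp add: fun_eq_iff)

lemma scal_closed [simp, intro]: "v \<in> bvecs n \<Longrightarrow> scal c v \<in> bvecs n"
  by (simp add: bvecs_def scal_def)

lemma dot_commute: "dot n u v = dot n v u"
  by (simp add: dot_def mult.commute)

lemma dot_add_right: "dot n u (v + w) = dot n u v + dot n u w"
  by (simp add: dot_def distrib_left sum.distrib)

lemma dot_add_left: "dot n (u + v) w = dot n u w + dot n v w"
  by (simp add: dot_def distrib_right sum.distrib)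

lemma dot_zero [simp]: "dot n u 0 = 0" "dot n 0 u = 0"
  by (simp_all add: dot_def)

lemma dot_scal: "dot n u (scal c v) = c * dot n u v" "dot n (scal c u) v = c * dot n u v"
  by (cases c; simp)+

lemma dot_nondeg:
  assumes "u \<in> bvecs n" "\<And>v. v \<in> bvecs n \<Longrightarrow> dot n u v = 0" shows "u = 0"
proof
  fix j
  show "u j = 0 j"
  proof (cases "j < n")
    case True
    define e :: "nat \<Rightarrow> bit" where "e = (\<lambda>i. of_bool (i = j))"
    have "e \<in> bvecs n" using True by (auto simp: e_def bvecs_def)
    moreover have "dot n u e = u j"
      using True by (simp add: dot_def e_def of_bool_def if_distrib sum.delta cong: if_cong)
    ultimately show ?thesis using assms(2) by simp
  qed (use assms in \<open>auto simp: bvecs_def\<close>)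
qed

lemma dot_eqI:
  assumes "u \<in> bvecs n" "v \<in> bvecs n" "\<And>w. w \<in> bvecs n \<Longrightarrow> dot n u w = dot n v w" shows "u = v"
  using dot_nondeg[of "u + v" n] assms by (auto simp: dot_add_left vec_add_eq_0_iff)

lemma mv_closed [simp, intro]: "mv n M v \<in> bvecs n"
  by (simp add: mv_def bvecs_def)

lemma mv_add: "mv n M (u + v) = mv n M u + mv n M v"
  by (auto simp: mv_def fun_eq_iff distrib_left sum.distrib)

lemma mv_add_mat:
  assumes "A \<in> carrier_mat n n" "B \<in> carrier_mat n n"
  shows "mv n (A + B) v = mv n A v + mv n B v"
  using assms by (auto simp: mv_def fun_eq_iff distrib_right sum.distrib)

lemma mv_outer:
  assumes "y \<in> bvecs n" shows "mv n (outer n y) v = scal (dot n y v) y"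
  using assms by (auto simp: mv_def fun_eq_iff outer_def scal_def dot_def bvecs_def
      sum_distrib_left sum_distrib_right mult_ac intro!: sum.cong)

lemma mv_mult_mat_vec: "M \<in> carrier_mat n n \<Longrightarrow> i < n \<Longrightarrow> (M *\<^sub>v vec n v) $ i = mv n M v i"
  by (auto simp: mv_def scalar_prod_def atLeast0LessThan)

lemma vec_mv: "M \<in> carrier_mat n n \<Longrightarrow> vec n (mv n M v) = M *\<^sub>v vec n v"
  by (intro eq_vecI) (auto simp: mv_mult_mat_vec simp del: index_mult_mat_vec)

lemma bvecs_eqI: "u \<in> bvecs n \<Longrightarrow> v \<in> bvecs n \<Longrightarrow> vec n u = vec n v \<Longrightarrow> u = v"
  by (auto simp: bvecs_def fun_eq_iff vec_eq_iff) (metis not_le)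

lemma mv_mult:
  assumes "A \<in> carrier_mat n n" "B \<in> carrier_mat n n" "A * B = 1\<^sub>m n" "v \<in> bvecs n"
  shows "mv n A (mv n B v) = v"
proof (rule bvecs_eqI[of _ n])
  have "vec n (mv n A (mv n B v)) = A *\<^sub>v (B *\<^sub>v vec n v)" using assms by (simp add: vec_mv)
  also have "\<dots> = (A * B) *\<^sub>v vec n v" using assms(1,2) by (simp add: assoc_mult_mat_vec[of A n n B n])
  finally show "vec n (mv n A (mv n B v)) = vec n v" using assms by simp
qed (use assms in auto)

text \<open>Additivity is linearity over the binary field, and the last clause is self-adjointness
  for \<open>dot\<close>. Operators allow matrices, their sums and their inverses to be treated
  alike.\<close>

definition symop :: "nat \<Rightarrow> ((nat \<Rightarrow> bit) \<Rightarrow> nat \<Rightarrow> bit) \<Rightarrow> bool" where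
  "symop n S \<longleftrightarrow> (\<forall>v\<in>bvecs n. S v \<in> bvecs n) \<and> (\<forall>u\<in>bvecs n. \<forall>v\<in>bvecs n. S (u + v) = S u + S v)
    \<and> (\<forall>u\<in>bvecs n. \<forall>v\<in>bvecs n. dot n u (S v) = dot n (S u) v)"

definition invop :: "nat \<Rightarrow> ((nat \<Rightarrow> bit) \<Rightarrow> nat \<Rightarrow> bit) \<Rightarrow> ((nat \<Rightarrow> bit) \<Rightarrow> nat \<Rightarrow> bit) \<Rightarrow> bool" where
  "invop n A C \<longleftrightarrow> symop n A \<and> (\<forall>v\<in>bvecs n. C v \<in> bvecs n \<and> A (C v) = v \<and> C (A v) = v)"

lemma symopD:
  assumes "symop n S"
  shows "v \<in> bvecs n \<Longrightarrow> S v \<in> bvecs n" "u \<in> bvecs n \<Longrightarrow> v \<in> bvecs n \<Longrightarrow> S (u + v) = S u + S v"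
    "u \<in> bvecs n \<Longrightarrow> v \<in> bvecs n \<Longrightarrow> dot n u (S v) = dot n (S u) v"
  using assms by (auto simp: symop_def)

lemma symop_zero: "symop n S \<Longrightarrow> S 0 = 0"
  using symopD(2)[of n S 0 0] by simp

lemma symop_scal: "symop n S \<Longrightarrow> S (scal c v) = scal c (S v)"
  by (cases c) (auto simp: symop_zero)

lemma symop_plus: "symop n S \<Longrightarrow> symop n T \<Longrightarrow> symop n (\<lambda>v. S v + T v)"
  by (auto simp: symop_def dot_add_left dot_add_right add_ac)

lemma invopD:
  assumes "invop n A C"
  shows "symop n A" "v \<in> bvecs n \<Longrightarrow> C v \<in> bvecs n" "v \<in> bvecs n \<Longrightarrow> A (C v) = v" "v \<in> bvecs n \<Longrightarrow> C (A v) = v"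
  using assms by (auto simp: invop_def)

lemma invop_symop_inverse:
  assumes "invop n A C" shows "symop n C"
proof -
  note A = symopD[OF invopD(1)[OF assms]] and C = invopD(2-4)[OF assms]
  have "C (u + v) = C u + C v" if "u \<in> bvecs n" "v \<in> bvecs n" for u v
    using A(2)[of "C u" "C v"] C that by (metis bvecs_closed(2))
  moreover have "dot n u (C v) = dot n (C u) v" if "u \<in> bvecs n" "v \<in> bvecs n" for u v
    using A(3)[of "C u" "C v"] C that by metis
  ultimately show ?thesis using C by (simp add: symop_def)
qed

lemma symop_mv:
  assumes "A \<in> carrier_mat n n" "transpose_mat A = A" shows "symop n (mv n A)"
proof -
  have A: "A $$ (i, j) = A $$ (j, i)" if "i < n" "j < n" for i j
    using assms that by (metis carrier_matD index_transpose_mat(1))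
  have "dot n u (mv n A v) = dot n (mv n A u) v" for u v
  proof -
    have "dot n u (mv n A v) = (\<Sum>i<n. \<Sum>j<n. u i * A $$ (i, j) * v j)"
      by (simp add: dot_def mv_def sum_distrib_left mult.assoc)
    also have "\<dots> = (\<Sum>j<n. \<Sum>i<n. u i * A $$ (i, j) * v j)" by (rule sum.swap)
    also have "\<dots> = dot n (mv n A u) v"
      by (auto simp: dot_def mv_def sum_distrib_left sum_distrib_right A mult_ac intro!: sum.cong)
    finally show ?thesis .
  qed
  then show ?thesis by (simp add: symop_def mv_add)
qed

section \<open>Invertible symmetric matrices\<close>

lemma SGL_D:
  assumes "A \<in> SGL n"
  shows "A \<in> carrier_mat n n" "symop n (mv n A)"
  using assms symop_mv by (auto simp: SGL_def)

lemma invop_mv: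
  assumes "A \<in> SGL n" "C \<in> carrier_mat n n" "inverts_mat A C" "inverts_mat C A"
  shows "invop n (mv n A) (mv n C)"
proof -
  have "A * C = 1\<^sub>m n" "C * A = 1\<^sub>m n" using assms by (auto simp: inverts_mat_def SGL_def)
  then show ?thesis using assms SGL_D[OF assms(1)] by (simp add: invop_def mv_mult)
qed

lemma SGL_obtain_inverse:
  assumes "A \<in> SGL n" obtains C where "invop n (mv n A) C"
proof -
  obtain C where C: "inverts_mat A C" "inverts_mat C A"
    using assms by (auto simp: SGL_def invertible_mat_def)
  have "dim_row A = n" "dim_col A = n" using assms by (auto simp: SGL_def)
  then have "dim_col C = n" "dim_row C = n"
    using C unfolding inverts_mat_def by (metis index_mult_mat(3) index_one_mat(3))+
  then show ?thesis using that invop_mv[OF assms _ C] by blast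
qed

lemma SGL_I:
  assumes A: "A \<in> carrier_mat n n" and "transpose_mat A = A"
    and ker: "\<And>v. v \<in> bvecs n \<Longrightarrow> mv n A v = 0 \<Longrightarrow> v = 0"
  shows "A \<in> SGL n"
proof -
  have "det A \<noteq> 0"
  proof
    assume "det A = 0"
    then obtain v where v: "v \<in> carrier_vec n" "v \<noteq> 0\<^sub>v n" "A *\<^sub>v v = 0\<^sub>v n"
      using det_0_iff_vec_prod_zero_field[OF A] by blast
    define f where "f = (\<lambda>j. if j < n then v $ j else 0)"
    have vf: "vec n f = v" using v by (intro eq_vecI) (auto simp: f_def)
    have "mv n A f = 0"
    proof (rule bvecs_eqI[of _ n])
      show "vec n (mv n A f) = vec n 0" using vf v by (simp add: vec_mv[OF A] zero_vec_def zero_fun_def)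
    qed auto
    then have "f = 0" using ker by (simp add: bvecs_def f_def)
    then show False using v vf by (auto simp: zero_vec_def zero_fun_def)
  qed
  then obtain C where C: "C \<in> carrier_mat n n" "A * C = 1\<^sub>m n" "C * A = 1\<^sub>m n"
    using det_non_zero_imp_unit[OF A, of "()"] unfolding Units_def ring_mat_def by auto
  then have "invertible_mat A"
    using A unfolding invertible_mat_def inverts_mat_def square_mat.simps by auto
  then show ?thesis using assms by (simp add: SGL_def)
qed

lemma outer_carrier [simp]: "outer n y \<in> carrier_mat n n"
  by (simp add: outer_def)

lemma dim_outer [simp]: "dim_row (outer n y) = n" "dim_col (outer n y) = n"
  by (simp_all add: outer_def)

lemma transpose_outer [simp]: "transpose_mat (outer n y) = outer n y"
  by (intro eq_matI) (auto simp: outer_def mult.commute)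

lemma SGL_add_outer:
  assumes B: "B \<in> SGL n" and y: "y \<in> bvecs n"
    and inj: "\<And>v. v \<in> bvecs n \<Longrightarrow> mv n B v + scal (dot n y v) y = 0 \<Longrightarrow> v = 0"
  shows "B + outer n y \<in> SGL n"
proof (rule SGL_I)
  show "transpose_mat (B + outer n y) = B + outer n y"
    using B transpose_add[of B n n "outer n y"] by (simp add: SGL_def)
  show "v = 0" if "v \<in> bvecs n" "mv n (B + outer n y) v = 0" for v
  proof (rule inj[OF that(1)])
    show "mv n B v + scal (dot n y v) y = 0"
      using that(2) by (simp only: mv_add_mat[OF SGL_D(1)[OF B] outer_carrier] mv_outer[OF y])
  qed
qed (use SGL_D[OF B] in auto)


section \<open>Symmetric matrices of rank one\<close>

lemma rank_ge_length_indep_cols: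
  fixes M :: "'a::field mat"
  assumes M: "M \<in> carrier_mat n nc" and cs: "set cs \<subseteq> set (cols M)" "distinct cs"
    and ind: "\<And>v. v \<in> carrier_vec (length cs) \<Longrightarrow> mat_of_cols n cs *\<^sub>v v = 0\<^sub>v n \<Longrightarrow> v = 0\<^sub>v (length cs)"
  shows "vec_space.rank n M \<ge> length cs"
proof -
  interpret vec_space "TYPE('a)" n .
  have dim: "set cs \<subseteq> carrier_vec n" using cs(1) cols_dim[of M] M by auto
  then have cols: "cols (mat_of_cols n cs) = cs" by (rule cols_mat_of_cols)
  have "lin_indpt (set cs)"
  proof (rule ccontr)
    assume "\<not> lin_indpt (set cs)"
    then obtain v where "v \<in> carrier_vec (length cs)" "v \<noteq> 0\<^sub>v (length cs)" "mat_of_cols n cs *\<^sub>v v = 0\<^sub>v n"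
      using lin_depE[OF mat_of_cols_carrier(1)[of n cs]] cols cs by metis
    then show False using ind by blast
  qed
  from rank_ge_card_indpt[OF M cs(1) this] show ?thesis
    using distinct_card[OF cs(2)] by simp
qed

lemma rank_pos_bit:
  fixes M :: "bit mat"
  assumes M: "M \<in> carrier_mat n nc" and ij: "i < n" "j < nc" "M $$ (i, j) = 1"
  shows "vec_space.rank n M \<ge> 1"
proof -
  have "vec_space.rank n M \<ge> length [col M j]"
  proof (rule rank_ge_length_indep_cols[OF M])
    show "set [col M j] \<subseteq> set (cols M)" using M ij by (auto simp: cols_def)
    fix v :: "bit vec" assume v: "v \<in> carrier_vec (length [col M j])" "mat_of_cols n [col M j] *\<^sub>v v = 0\<^sub>v n"
    have "(mat_of_cols n [col M j] *\<^sub>v v) $ i = v $ 0"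
      using M ij v(1) by (simp add: scalar_prod_def mat_of_cols_index)
    then have "v $ 0 = 0" using v(2) ij by simp
    then show "v = 0\<^sub>v (length [col M j])" using v by (intro eq_vecI) auto
  qed simp
  then show ?thesis by simp
qed

text \<open>Over the binary field two distinct nonzero columns are independent. The entries at
  \<open>(i, j)\<close> and \<open>(k, l)\<close> show that the columns are nonzero, and row
  \<open>p\<close> that they differ.\<close>

lemma rank_ge_2_bit:
  fixes M :: "bit mat"
  assumes M: "M \<in> carrier_mat n nc"
    and ij: "i < n" "j < nc" "M $$ (i, j) = 1" and kl: "k < n" "l < nc" "M $$ (k, l) = 1"
    and p: "p < n" "M $$ (p, j) \<noteq> M $$ (p, l)"
  shows "vec_space.rank n M \<ge> 2"
proof -
  let ?cs = "[col M j, col M l]"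
  have jl: "col M j $ q = M $$ (q, j)" "col M l $ q = M $$ (q, l)" if "q < n" for q
    using that M ij kl by auto
  have "vec_space.rank n M \<ge> length ?cs"
  proof (rule rank_ge_length_indep_cols[OF M])
    show "set ?cs \<subseteq> set (cols M)" using M ij kl by (auto simp: cols_def)
    show "distinct ?cs" using jl[OF p(1)] p(2) by auto
    fix v :: "bit vec" assume v: "v \<in> carrier_vec (length ?cs)" "mat_of_cols n ?cs *\<^sub>v v = 0\<^sub>v n"
    have eq: "M $$ (q, j) * v $ 0 + M $$ (q, l) * v $ 1 = 0" if "q < n" for q
    proof -
      have "(mat_of_cols n ?cs *\<^sub>v v) $ q = M $$ (q, j) * v $ 0 + M $$ (q, l) * v $ 1"
        using that v(1) jl[OF that] by (simp add: scalar_prod_def mat_of_cols_index)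
      then show ?thesis using v(2) that by simp
    qed
    have "v $ 0 = 0 \<and> v $ 1 = 0"
      using eq[OF ij(1)] eq[OF kl(1)] eq[OF p(1)] ij kl p(2)
      by (cases "v $ 0"; cases "v $ 1") auto
    then show "v = 0\<^sub>v (length ?cs)"
      using v by (intro eq_vecI) (auto simp: less_Suc_eq)
  qed
  then show ?thesis by simp
qed

text \<open>In rank one all nonzero columns coincide, and by symmetry the common column also tells
  which columns are nonzero; so the matrix is an outer square, whose root is the diagonal. Serves
  both for adjacency and for the Gram matrix.\<close>

lemma rank_one_symmetric_bit_iff:
  fixes M :: "bit mat"
  assumes M: "M \<in> carrier_mat n n" and sym: "\<And>i j. i < n \<Longrightarrow> j < n \<Longrightarrow> M $$ (i, j) = M $$ (j, i)"
  shows "vec_space.rank n M = 1 \<longleftrightarrow>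
    (\<forall>i<n. \<forall>j<n. M $$ (i, j) = M $$ (i, i) * M $$ (j, j)) \<and> (\<exists>i<n. M $$ (i, i) = 1)"
    (is "_ \<longleftrightarrow> ?P \<and> ?Q")
proof
  assume r: "vec_space.rank n M = 1"
  have "M \<noteq> 0\<^sub>m n n" using r vec_space.rank_0I[of n n] by (metis zero_neq_one)
  then obtain i j where ij: "i < n" "j < n" "M $$ (i, j) = 1"
    using M by (auto simp: mat_eq_iff)
  have eqcol: "M $$ (p, j) = M $$ (p, l)" if "p < n" "k < n" "l < n" "M $$ (k, l) = 1" for p k l
    using rank_ge_2_bit[OF M ij that(2-4,1)] r by fastforce
  have prod: "M $$ (p, l) = M $$ (p, j) * M $$ (l, j)" if "p < n" "l < n" for p l
  proof (cases "M $$ (l, j) = 1")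
    case True
    then have "M $$ (j, l) = 1" using sym ij that by metis
    then show ?thesis using eqcol[OF that(1) ij(2) that(2)] True by simp
  next
    case False
    have "M $$ (p, l) \<noteq> 1"
    proof
      assume 1: "M $$ (p, l) = 1"
      then have "M $$ (j, p) = 1" using eqcol[OF that(1) that 1] sym[OF that(1) ij(2)] by simp
      then show False using eqcol[OF that(2) ij(2) that(1)] sym[OF that] 1 False by simp
    qed
    then show ?thesis using False by simp
  qed
  have "M $$ (p, p) = M $$ (p, j)" if "p < n" for p using prod[OF that that] by simp
  then have "?P" using prod by simp
  moreover have "?Q" using prod[OF ij(1,1)] ij by auto
  ultimately show "?P \<and> ?Q" ..
next
  assume PQ: "?P \<and> ?Q"
  then obtain i where "i < n" "M $$ (i, i) = 1" by blast
  then have "vec_space.rank n M \<ge> 1" using rank_pos_bit[OF M] by blast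
  moreover have "vec_space.rank n M \<le> 1"
  proof (rule vec_space.rank_le_1_product_entries[OF M])
    fix r c assume "r < dim_row M" "c < dim_col M"
    then have "r < n" "c < n" using M by auto
    then show "M $$ (r, c) = M $$ (r, r) * M $$ (c, c)" using PQ by blast
  qed
  ultimately show "vec_space.rank n M = 1" by simp
qed

lemma mv_inj:
  assumes "A \<in> carrier_mat n n" "B \<in> carrier_mat n n" "\<And>v. v \<in> bvecs n \<Longrightarrow> mv n A v = mv n B v"
  shows "A = B"
proof (rule eq_matI)
  fix i j assume "i < dim_row B" "j < dim_col B"
  then have ij: "i < n" "j < n" using assms by auto
  define e :: "nat \<Rightarrow> bit" where "e = (\<lambda>i. of_bool (i = j))"
  have "e \<in> bvecs n" using ij by (auto simp: e_def bvecs_def)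
  moreover have "mv n M e i = M $$ (i, j)" for M
    using ij by (simp add: mv_def e_def of_bool_def if_distrib sum.delta cong: if_cong)
  ultimately show "A $$ (i, j) = B $$ (i, j)" using assms(3) by metis
qed (use assms in auto)

section \<open>Adjacency and walks\<close>

text \<open>The difference equals the sum in characteristic two, and \<open>y\<close> is its
  diagonal.\<close>

lemma gamma_adj_iff:
  assumes A: "A \<in> SGL n" and B: "B \<in> SGL n"
  shows "gamma_adj n A B \<longleftrightarrow> (\<exists>y\<in>bvecs n. y \<noteq> 0 \<and> B = A + outer n y)"
proof -
  define M where "M = A - B"
  have cA: "A \<in> carrier_mat n n" and cB: "B \<in> carrier_mat n n" using SGL_D A B by auto
  have M: "M \<in> carrier_mat n n" using cA cB by (simp add: M_def minus_carrier_mat)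
  have Mij: "M $$ (i, j) = A $$ (i, j) + B $$ (i, j)" if "i < n" "j < n" for i j
    using that cA cB by (simp add: M_def)
  have sym: "X $$ (i, j) = X $$ (j, i)" if "X \<in> SGL n" "i < n" "j < n" for X i j
    using that unfolding SGL_def by (metis (mono_tags, lifting) carrier_matD index_transpose_mat(1) mem_Collect_eq)
  have symM: "M $$ (i, j) = M $$ (j, i)" if "i < n" "j < n" for i j
    using that sym[OF A that] sym[OF B that] by (simp add: Mij)
  have "gamma_adj n A B \<longleftrightarrow>
     (\<forall>i<n. \<forall>j<n. M $$ (i, j) = M $$ (i, i) * M $$ (j, j)) \<and> (\<exists>i<n. M $$ (i, i) = 1)" (is "_ \<longleftrightarrow> ?P")
    using rank_one_symmetric_bit_iff[OF M symM] A B by (simp add: gamma_adj_def M_def)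
  also have "\<dots> \<longleftrightarrow> (\<exists>y\<in>bvecs n. y \<noteq> 0 \<and> B = A + outer n y)"
  proof
    assume P: ?P
    define y where "y = (\<lambda>i. if i < n then M $$ (i, i) else 0)"
    have "B $$ (i, j) = (A + outer n y) $$ (i, j)" if "i < n" "j < n" for i j
    proof -
      have "M $$ (i, j) = M $$ (i, i) * M $$ (j, j)" using P that by blast
      then have "A $$ (i, j) + B $$ (i, j) = y i * y j" using that Mij[OF that] by (simp add: y_def)
      then show ?thesis using that cA by (auto simp: outer_def) (metis bit_add_self add.assoc add_0)
    qed
    then have "B = A + outer n y" using cA cB by (intro eq_matI) auto
    moreover have "y \<noteq> 0"
    proof -
      obtain i where "i < n" "M $$ (i, i) = 1" using P by blast
      then have "y i \<noteq> 0" by (simp add: y_def)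
      then show ?thesis by auto
    qed
    moreover have "y \<in> bvecs n" by (simp add: y_def bvecs_def)
    ultimately show "\<exists>y\<in>bvecs n. y \<noteq> 0 \<and> B = A + outer n y" by blast
  next
    assume "\<exists>y\<in>bvecs n. y \<noteq> 0 \<and> B = A + outer n y"
    then obtain y where y: "y \<in> bvecs n" "y \<noteq> 0" "B = A + outer n y" by blast
    have Me: "M $$ (i, j) = y i * y j" if "i < n" "j < n" for i j
      using that cA y(3) Mij[OF that] by (simp add: outer_def flip: add.assoc)
    obtain i where "y i \<noteq> 0" using y(2) by (auto simp: fun_eq_iff)
    then have "i < n" "y i = 1" using y(1) by (auto simp: bvecs_def) (metis not_le zero_neq_one)
    then show ?P using Me by auto
  qed
  finally show ?thesis .
qed

lemma gamma_adj_outer: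
  "A \<in> SGL n \<Longrightarrow> A + outer n y \<in> SGL n \<Longrightarrow> y \<in> bvecs n \<Longrightarrow> y \<noteq> 0 \<Longrightarrow> gamma_adj n A (A + outer n y)"
  using gamma_adj_iff by blast

lemma add_outer_twice: "B \<in> carrier_mat n n \<Longrightarrow> B + outer n y + outer n y = B"
  by (intro eq_matI) (auto simp: outer_def add.assoc)

lemma gamma_adj_outer':
  assumes "B \<in> SGL n" "B + outer n y \<in> SGL n" "y \<in> bvecs n" "y \<noteq> 0"
  shows "gamma_adj n (B + outer n y) B"
  using gamma_adj_outer[OF assms(2) _ assms(3,4)] add_outer_twice[OF SGL_D(1)[OF assms(1)]] assms(1) by simp

lemma gamma_walk_snoc:
  assumes "gamma_walk n k A B" "gamma_adj n B D" shows "gamma_walk n (Suc k) A D"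
proof -
  obtain p where p: "p 0 = A" "p k = B" "\<forall>i\<le>k. p i \<in> SGL n" "\<forall>i<k. gamma_adj n (p i) (p (Suc i))"
    using assms(1) by (auto simp: gamma_walk_def)
  define q where "q = p(Suc k := D)"
  have "q 0 = A" "q (Suc k) = D" "\<forall>i\<le>Suc k. q i \<in> SGL n" "\<forall>i<Suc k. gamma_adj n (q i) (q (Suc i))"
    using p assms(2) by (auto simp: q_def gamma_adj_def less_Suc_eq)
  then show ?thesis unfolding gamma_walk_def by blast
qed

lemma gamma_walk_0: "A \<in> SGL n \<Longrightarrow> gamma_walk n 0 A A"
  unfolding gamma_walk_def by (intro exI[of _ "\<lambda>_. A"]) simp

lemma gamma_walk_one:
  assumes "gamma_adj n A B" shows "gamma_walk n 1 A B"
  using gamma_walk_snoc[OF gamma_walk_0 assms] assms by (simp add: gamma_adj_def)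

section \<open>The form induced by an operator on its image\<close>

text \<open>The form that sends \<open>S \<xi>\<close> and \<open>S \<eta>\<close> to
  \<open>dot n \<xi> (S \<eta>)\<close>; the choice operator merely picks a preimage.\<close>

definition img_form :: "nat \<Rightarrow> ((nat \<Rightarrow> bit) \<Rightarrow> nat \<Rightarrow> bit) \<Rightarrow> (nat \<Rightarrow> bit) \<Rightarrow> (nat \<Rightarrow> bit) \<Rightarrow> bit" where
  "img_form n S u w = dot n (SOME \<xi>. \<xi> \<in> bvecs n \<and> S \<xi> = u) w"

text \<open>Independence of the preimage: for \<open>w = S \<eta>\<close>, self-adjointness turns
  \<open>dot n \<zeta> w\<close> into \<open>dot n (S \<zeta>) \<eta>\<close>.\<close>

lemma img_form_eq:
  assumes S: "symop n S" and "\<xi> \<in> bvecs n" "w \<in> S ` bvecs n"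
  shows "img_form n S (S \<xi>) w = dot n \<xi> w"
proof -
  define \<zeta> where "\<zeta> = (SOME \<zeta>. \<zeta> \<in> bvecs n \<and> S \<zeta> = S \<xi>)"
  have z: "\<zeta> \<in> bvecs n" "S \<zeta> = S \<xi>"
    unfolding \<zeta>_def using someI[of "\<lambda>\<zeta>. \<zeta> \<in> bvecs n \<and> S \<zeta> = S \<xi>" \<xi>] assms(2) by auto
  obtain \<eta> where e: "\<eta> \<in> bvecs n" "w = S \<eta>" using assms(3) by blast
  have "dot n \<zeta> w = dot n \<xi> w" using z e assms symopD(3)[OF S] by metis
  then show ?thesis by (simp add: img_form_def \<zeta>_def)
qed

lemma subsp_image: assumes S: "symop n S" shows "subsp (S ` bvecs n)"
  unfolding subsp_def
proof (intro conjI ballI)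
  show "finite (S ` bvecs n)" using subspD(1)[OF subsp_bvecs] by blast
  show "0 \<in> S ` bvecs n" using symop_zero[OF S] by (metis bvecs_closed(1) imageI)
  show "u + v \<in> S ` bvecs n" if "u \<in> S ` bvecs n" "v \<in> S ` bvecs n" for u v
  proof -
    obtain \<xi> \<eta> where "\<xi> \<in> bvecs n" "u = S \<xi>" "\<eta> \<in> bvecs n" "v = S \<eta>" using \<open>u \<in> _\<close> \<open>v \<in> _\<close> by blast
    then show ?thesis using symopD(2)[OF S, of \<xi> \<eta>] by (intro image_eqI[of _ _ "\<xi> + \<eta>"]) auto
  qed
qed simp

lemma sym_form_img:
  assumes S: "symop n S" shows "sym_form (S ` bvecs n) (img_form n S)"
  unfolding sym_form_def lin_on_def
proof (intro conjI ballI)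
  fix u v w assume "u \<in> S ` bvecs n" "v \<in> S ` bvecs n" "w \<in> S ` bvecs n"
  then show "img_form n S u (v + w) = img_form n S u v + img_form n S u w"
    using subspD(3)[OF subsp_image[OF S]] by (auto simp: img_form_eq[OF S] dot_add_right)
next
  fix u v assume "u \<in> S ` bvecs n" "v \<in> S ` bvecs n"
  then show "img_form n S u v = img_form n S v u"
    by (auto simp: img_form_eq[OF S]) (metis symopD(3)[OF S] dot_commute)
qed

lemma nondeg_img:
  assumes S: "symop n S" shows "nondeg (S ` bvecs n) (img_form n S)"
  unfolding nondeg_def
proof (intro ballI impI)
  fix u assume "u \<in> S ` bvecs n" and perp: "\<forall>v\<in>S ` bvecs n. img_form n S u v = 0"
  then obtain \<xi> where x: "\<xi> \<in> bvecs n" "u = S \<xi>" by blast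
  show "u = 0"
  proof (rule dot_nondeg)
    fix \<eta> assume e: "\<eta> \<in> bvecs n"
    then have "dot n \<xi> (S \<eta>) = 0" using perp x img_form_eq[OF S x(1)] by auto
    then show "dot n u \<eta> = 0" using symopD(3)[OF S x(1) e] x by simp
  qed (use x symopD[OF S] in auto)
qed

lemma invop_form:
  assumes "invop n A C" "U \<subseteq> bvecs n" shows "sym_form U (\<lambda>u v. dot n u (C v))"
proof -
  note C = symopD[OF invop_symop_inverse[OF assms(1)]]
  have "dot n u (C v) = dot n v (C u)" if "u \<in> U" "v \<in> U" for u v
    using C(3) that assms(2) dot_commute by (metis subsetD)
  moreover have "C (u + v) = C u + C v" if "u \<in> U" "v \<in> U" for u v
    using C(2) that assms(2) by blast
  ultimately show ?thesis by (simp add: sym_form_def lin_on_def dot_add_right)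
qed

text \<open>With \<open>S = A + B\<close>, \<open>u = S \<xi>\<close> and \<open>C\<close> the inverse of \<open>A\<close>, orthogonality to the image of \<open>S\<close> means
  \<open>0 = S (\<xi> + C (S \<xi>)) = S (C (B \<xi>)) = B (C (S \<xi>))\<close>.\<close>

lemma nondeg_img_plus_inverse:
  assumes A: "invop n A C" and B: "invop n B D" and xi: "\<xi> \<in> bvecs n"
    and perp: "\<And>\<eta>. \<eta> \<in> bvecs n \<Longrightarrow>
      dot n \<xi> (A \<eta> + B \<eta>) + dot n (A \<xi> + B \<xi>) (C (A \<eta> + B \<eta>)) = 0"
  shows "A \<xi> + B \<xi> = 0"
proof -
  note A' = symopD[OF invopD(1)[OF A]] and B' = symopD[OF invopD(1)[OF B]]
    and C' = symopD[OF invop_symop_inverse[OF A]]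
  define S where "S = (\<lambda>v. A v + B v)"
  have S: "symop n S" unfolding S_def by (intro symop_plus invopD(1)[OF A] invopD(1)[OF B])
  note S' = symopD[OF S]
  have cl: "S \<xi> \<in> bvecs n" "C (S \<xi>) \<in> bvecs n" using S' C' xi by auto
  have "S (\<xi> + C (S \<xi>)) = 0"
  proof (rule dot_nondeg)
    fix \<eta> assume e: "\<eta> \<in> bvecs n"
    have "dot n (S (\<xi> + C (S \<xi>))) \<eta> = dot n (\<xi> + C (S \<xi>)) (S \<eta>)" using S'(3) xi cl e by simp
    also have "\<dots> = dot n \<xi> (S \<eta>) + dot n (S \<xi>) (C (S \<eta>))"
      using C'(3)[OF cl(1) S'(1)[OF e]] by (simp add: dot_add_left)
    also have "\<dots> = 0" using perp[OF e] by (simp add: S_def)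
    finally show "dot n (S (\<xi> + C (S \<xi>))) \<eta> = 0" .
  qed (use S' xi cl in auto)
  moreover have "S (\<xi> + C (S \<xi>)) = B (C (S \<xi>))"
  proof -
    have "A (C (S \<xi>)) = S \<xi>" using invopD(3)[OF A] cl by simp
    then show ?thesis using S'(2)[OF xi cl(2)] by (simp add: S_def)
  qed
  ultimately have "B (C (S \<xi>)) = 0" by simp
  then have "C (S \<xi>) = 0" using invopD(4)[OF B cl(2)] symop_zero[OF invop_symop_inverse[OF B]] by simp
  then have "S \<xi> = 0" using invopD(3)[OF A cl(1)] symop_zero[OF invopD(1)[OF A]] by simp
  then show ?thesis by (simp add: S_def)
qed

text \<open>In characteristic two this is the operator of \<open>B - A\<close>.\<close>

definition sumop :: "nat \<Rightarrow> bit mat \<Rightarrow> bit mat \<Rightarrow> (nat \<Rightarrow> bit) \<Rightarrow> nat \<Rightarrow> bit" where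
  "sumop n A B v = mv n A v + mv n B v"

lemma symop_sumop: "A \<in> SGL n \<Longrightarrow> B \<in> SGL n \<Longrightarrow> symop n (sumop n A B)"
  unfolding sumop_def by (intro symop_plus SGL_D)

lemma sumop_add_outer:
  assumes "B \<in> SGL n" "y \<in> bvecs n"
  shows "sumop n A (B + outer n y) v = sumop n A B v + scal (dot n y v) y"
  using assms SGL_D by (simp add: sumop_def mv_add_mat mv_outer add.assoc)

text \<open>Here invertibility of \<open>B\<close> turns into nondegeneracy of the second form, as
  \<open>choose_hyperplane\<close> requires.\<close>

lemma nondeg_sum_form:
  assumes A: "A \<in> SGL n" and B: "B \<in> SGL n" and C: "invop n (mv n A) C"
  shows "nondeg (sumop n A B ` bvecs n) (\<lambda>u v. img_form n (sumop n A B) u v + dot n u (C v))"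
  unfolding nondeg_def
proof (intro ballI impI)
  let ?S = "sumop n A B"
  note S = symop_sumop[OF A B]
  obtain D where D: "invop n (mv n B) D" using SGL_obtain_inverse[OF B] .
  fix u assume u: "u \<in> ?S ` bvecs n" "\<forall>v\<in>?S ` bvecs n. img_form n ?S u v + dot n u (C v) = 0"
  then obtain \<xi> where x: "\<xi> \<in> bvecs n" "u = ?S \<xi>" by blast
  have "mv n A \<xi> + mv n B \<xi> = 0"
    by (rule nondeg_img_plus_inverse[OF C D x(1)])
       (use u(2) x img_form_eq[OF S x(1)] in \<open>auto simp: sumop_def\<close>)
  then show "u = 0" using x by (simp add: sumop_def)
qed

section \<open>Construction of walks\<close>

text \<open>With image \<open>{0, y}\<close> and \<open>y = S \<xi>\<close>, the coefficient of
  \<open>y\<close> in \<open>S v\<close> is \<open>dot n \<xi> (S v) = dot n y v\<close>, so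
  \<open>S\<close> is the outer square of \<open>y\<close>.\<close>

lemma walk_one_dimensional:
  assumes A: "A \<in> SGL n" and B: "B \<in> SGL n" and card: "card (sumop n A B ` bvecs n) = 2"
    and x: "\<xi> \<in> bvecs n" "dot n \<xi> (sumop n A B \<xi>) = 1"
  shows "gamma_walk n 1 A B"
proof -
  define S where "S = sumop n A B"
  have S: "symop n S" unfolding S_def by (rule symop_sumop[OF A B])
  note S' = symopD[OF S]
  have cA: "A \<in> carrier_mat n n" and cB: "B \<in> carrier_mat n n" using SGL_D A B by auto
  define y where "y = S \<xi>"
  have y: "y \<in> bvecs n" "dot n \<xi> y = 1" using x S' by (auto simp: y_def S_def)
  then have y0: "y \<noteq> 0" by auto
  have "{0, y} \<subseteq> S ` bvecs n" using x subspD(2)[OF subsp_image[OF S]] by (auto simp: y_def)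
  moreover have "card {0, y} = 2" using y0 by simp
  ultimately have im: "S ` bvecs n = {0, y}"
    using card_seteq[of "S ` bvecs n" "{0, y}"] card subspD(1)[OF subsp_image[OF S]] by (simp add: S_def)
  have Sv: "S v = scal (dot n y v) y" if v: "v \<in> bvecs n" for v
  proof -
    have "dot n y v = dot n \<xi> (S v)" using S'(3)[OF x(1) v] by (simp add: y_def)
    moreover have "S v = 0 \<or> S v = y" using im v by blast
    ultimately show ?thesis using y by auto
  qed
  have "B = A + outer n y"
  proof (rule mv_inj[OF cB])
    fix v assume v: "v \<in> bvecs n"
    have "mv n A v + S v = mv n B v" by (simp add: S_def sumop_def)
    then show "mv n B v = mv n (A + outer n y) v"
      using Sv[OF v] y by (simp add: mv_add_mat[OF cA] mv_outer)
  qed (use cA in simp)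
  then have "gamma_adj n A B" using gamma_adj_iff[OF A B] y y0 by blast
  then show ?thesis by (rule gamma_walk_one)
qed

text \<open>Induction from the far end: \<open>B\<close> is replaced by a neighbour
  \<open>B'\<close> for which the image shrinks to the hyperplane \<open>F\<close> and the forms are
  restricted to it, so that all hypotheses persist.\<close>

lemma walk_of_rank_length:
  assumes A: "A \<in> SGL n" and C: "invop n (mv n A) C"
    and "B \<in> SGL n" "card (sumop n A B ` bvecs n) = 2 ^ m"
    and "\<exists>\<xi>\<in>bvecs n. dot n \<xi> (sumop n A B \<xi>) = 1"
    and "\<exists>\<xi>\<in>bvecs n. dot n \<xi> (sumop n A B \<xi>) + dot n (sumop n A B \<xi>) (C (sumop n A B \<xi>)) = 1"
    and "\<not> rank_one_on (sumop n A B ` bvecs n) (\<lambda>u v. dot n u (C v))"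
  shows "gamma_walk n m A B"
  using assms(3-)
proof (induction m arbitrary: B)
  \<comment> \<open>Vacuous: a trivial image contradicts the existence of \<open>\<xi>\<close> with
    value 1.\<close>
  case 0
  note B = 0(1)
  have S: "symop n (sumop n A B)" by (rule symop_sumop[OF A B])
  obtain \<xi> where x: "\<xi> \<in> bvecs n" "dot n \<xi> (sumop n A B \<xi>) = 1" using 0 by blast
  obtain e where "sumop n A B ` bvecs n = {e}" using 0(2) by (auto simp: card_1_singleton_iff)
  then have "sumop n A B \<xi> = 0" using imageI[OF x(1), of "sumop n A B"] subspD(2)[OF subsp_image[OF S]] by simp
  then show ?case using x by simp
next
  case (Suc k)
  note B = Suc.prems(1)
  define S where "S = sumop n A B"
  define U where "U = S ` bvecs n"
  define s where "s = img_form n S"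
  define a where "a = (\<lambda>u v. dot n u (C v))"
  have S: "symop n S" unfolding S_def by (rule symop_sumop[OF A B])
  note S' = symopD[OF S] and C' = symopD[OF invop_symop_inverse[OF C]]
  have U: "subsp U" unfolding U_def by (rule subsp_image[OF S])
  have UV: "U \<subseteq> bvecs n" using S' by (auto simp: U_def)
  have s: "sym_form U s" unfolding U_def s_def by (rule sym_form_img[OF S])
  have nds: "nondeg U s" unfolding U_def s_def by (rule nondeg_img[OF S])
  have a: "sym_form U a" unfolding a_def by (rule invop_form[OF C UV])
  have ndb: "nondeg U (\<lambda>u v. s u v + a u v)"
    unfolding U_def s_def a_def S_def by (rule nondeg_sum_form[OF A B C])
  have seq: "s (S \<xi>) w = dot n \<xi> w" if "\<xi> \<in> bvecs n" "w \<in> U" for \<xi> w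
    using img_form_eq[OF S] that by (simp add: U_def s_def)
  show ?case
  proof (cases "k = 0")
    case True
    then show ?thesis using walk_one_dimensional[OF A B] Suc.prems by auto
  next
    case False
    have nas: "\<exists>u\<in>U. s u u = 1"
      using Suc.prems(3) seq unfolding U_def S_def[symmetric] by auto
    have nab: "\<exists>u\<in>U. s u u + a u u = 1"
      using Suc.prems(4) seq unfolding U_def a_def S_def[symmetric] by auto
    have nr: "\<not> rank_one_on U a" using Suc.prems(5) by (simp add: U_def S_def a_def)
    have card: "card U = 2 ^ Suc k" using Suc.prems(2) by (simp add: U_def S_def)
    obtain y where y: "y \<in> U" "s y y = 1" "nondeg {u \<in> U. s y u = 0} (\<lambda>u v. s u v + a u v)"
      "\<exists>u\<in>{u \<in> U. s y u = 0}. s u u = 1" "\<exists>u\<in>{u \<in> U. s y u = 0}. s u u + a u u = 1"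
      "\<not> rank_one_on {u \<in> U. s y u = 0} a"
      using choose_hyperplane[OF U s a nds ndb nas nab nr card] False by auto
    define F where "F = {u \<in> U. s y u = 0}"
    obtain \<zeta> where z: "\<zeta> \<in> bvecs n" "y = S \<zeta>" using y(1) by (auto simp: U_def)
    have sy: "s y w = dot n \<zeta> w" if "w \<in> U" for w using seq[OF z(1) that] z by simp
    have zy: "dot n \<zeta> y = 1" using sy[OF y(1)] y(2) by simp
    have yV: "y \<in> bvecs n" and y0: "y \<noteq> 0" using y(1) UV zy by auto
    define B' where "B' = B + outer n y"
    define T where "T = sumop n A B'"
    have T: "T v = S v + scal (dot n y v) y" for v
      unfolding T_def B'_def S_def by (rule sumop_add_outer[OF B yV])
    have TS: "T v = S (v + scal (dot n y v) \<zeta>)" if "v \<in> bvecs n" for v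
      using that z S'(2) by (simp add: T symop_scal[OF S])
    have TF: "T v \<in> F" if v: "v \<in> bvecs n" for v
    proof -
      have 1: "T v \<in> U" using TS[OF v] v z by (auto simp: U_def)
      have "s y (T v) = dot n \<zeta> (S v) + dot n y v"
        using sy[OF 1] zy by (simp add: T dot_add_right dot_scal)
      also have "\<dots> = 0" using S'(3)[OF z(1) v] z by simp
      finally show ?thesis using 1 by (simp add: F_def)
    qed
    \<comment> \<open>On preimages of \<open>F\<close> the operators agree, so the form induced by
      \<open>T\<close> is the restriction of \<open>s\<close>.\<close>
    have FT: "T \<xi> = S \<xi>" if "\<xi> \<in> bvecs n" "S \<xi> \<in> F" for \<xi>
    proof -
      have "dot n \<zeta> (S \<xi>) = 0" using that(2) sy by (auto simp: F_def)
      then have "dot n y \<xi> = 0" using S'(3)[OF z(1) that(1)] z by simp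
      then show ?thesis by (simp add: T)
    qed
    have im: "T ` bvecs n = F"
    proof
      show "F \<subseteq> T ` bvecs n"
      proof
        fix u assume u: "u \<in> F"
        then obtain \<xi> where "\<xi> \<in> bvecs n" "u = S \<xi>" by (auto simp: F_def U_def)
        then show "u \<in> T ` bvecs n" using FT[of \<xi>] u by (intro image_eqI[of _ _ \<xi>]) auto
      qed
    qed (use TF in auto)
    \<comment> \<open>A kernel vector \<open>v\<close> of \<open>B'\<close> satisfies
      \<open>T v = A v\<close>, so \<open>s (T v) w\<close> and \<open>a (T v) w\<close> both equal
      \<open>dot n v w\<close> for \<open>w\<close> in \<open>F\<close>. Hence \<open>T v\<close>
      lies in the radical of \<open>s + a\<close> on \<open>F\<close> and vanishes.\<close>
    have B': "B' \<in> SGL n" unfolding B'_def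
    proof (rule SGL_add_outer[OF B yV])
      fix v assume v: "v \<in> bvecs n" and e: "mv n B v + scal (dot n y v) y = 0"
      have "T v = mv n A v + (mv n B v + scal (dot n y v) y)" by (simp add: T S_def sumop_def add.assoc)
      then have TA: "T v = mv n A v" using e by simp
      have "s (T v) w + a (T v) w = 0" if w: "w \<in> F" for w
      proof -
        have wU: "w \<in> U" "w \<in> bvecs n" "dot n \<zeta> w = 0" using w UV sy by (auto simp: F_def)
        have "s (T v) w = dot n v w"
          using seq[OF _ wU(1), of "v + scal (dot n y v) \<zeta>"] TS[OF v] v z wU(3)
          by (simp add: dot_add_left dot_scal)
        moreover have "a (T v) w = dot n v w"
          using C'(3)[of "mv n A v" w] wU invopD(4)[OF C v] by (simp add: a_def TA)
        ultimately show ?thesis by simp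
      qed
      then have "T v = 0" using y(3) TF[OF v] unfolding nondeg_def F_def by blast
      then show "v = 0" using TA invopD(4)[OF C v] symop_zero[OF invop_symop_inverse[OF C]] by simp
    qed
    have "gamma_walk n k A B'"
    proof (rule Suc.IH[OF B', folded T_def])
      have "2 * card F = card U"
        unfolding F_def using card_half(1)[OF U sym_formD(1)[OF s y(1)] y(1)] y(2) by blast
      then show "card (T ` bvecs n) = 2 ^ k" using card im by simp
      obtain u where u: "u \<in> F" "s u u = 1" using y(4) by (auto simp: F_def)
      then obtain \<xi> where x: "\<xi> \<in> bvecs n" "u = S \<xi>" by (auto simp: F_def U_def)
      have "dot n \<xi> (T \<xi>) = 1" using FT[OF x(1)] seq[OF x(1), of u] u x by (auto simp: F_def)
      then show "\<exists>\<xi>\<in>bvecs n. dot n \<xi> (T \<xi>) = 1" using x by blast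
      obtain u where u: "u \<in> F" "s u u + a u u = 1" using y(5) by (auto simp: F_def)
      then obtain \<xi> where x: "\<xi> \<in> bvecs n" "u = S \<xi>" by (auto simp: F_def U_def)
      have "dot n \<xi> (T \<xi>) + dot n (T \<xi>) (C (T \<xi>)) = 1"
        using FT[OF x(1)] seq[OF x(1), of u] u x by (auto simp: F_def a_def)
      then show "\<exists>\<xi>\<in>bvecs n. dot n \<xi> (T \<xi>) + dot n (T \<xi>) (C (T \<xi>)) = 1" using x by blast
      show "\<not> rank_one_on (T ` bvecs n) (\<lambda>u v. dot n u (C v))"
        using y(6) unfolding im F_def a_def .
    qed
    moreover have "gamma_adj n B' B"
      unfolding B'_def by (rule gamma_adj_outer'[OF B _ yV y0]) (use B' B'_def in simp)
    ultimately show ?thesis by (rule gamma_walk_snoc)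
  qed
qed

section \<open>One extra step for an alternating difference\<close>

text \<open>A kernel vector is a multiple of \<open>D y\<close> with coefficient
  \<open>dot n y v\<close>; pairing with \<open>y\<close> shows that this coefficient is
  zero.\<close>

lemma SGL_add_outer_isotropic:
  assumes B: "B \<in> SGL n" and D: "invop n (mv n B) D" and y: "y \<in> bvecs n" "dot n y (D y) = 0"
  shows "B + outer n y \<in> SGL n"
proof (rule SGL_add_outer[OF B y(1)])
  fix v assume v: "v \<in> bvecs n" and "mv n B v + scal (dot n y v) y = 0"
  then have "mv n B v = scal (dot n y v) y" by (simp add: vec_add_eq_0_iff)
  then have e: "v = scal (dot n y v) (D y)"
    using invopD(4)[OF D v] symop_scal[OF invop_symop_inverse[OF D]] by metis
  then have "dot n y v = dot n y v * dot n y (D y)" using dot_scal(1) by metis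
  then show "v = 0" using y(2) e by simp
qed

text \<open>Alternation gives \<open>a d d = 0\<close>. If \<open>a d v\<close> were 1 for the
  second basis vector \<open>v\<close>, the forms \<open>s\<close> and \<open>a\<close> would agree
  at \<open>d\<close>, against \<open>nondeg_sum_form\<close>. So \<open>d\<close> is in the
  radical, and \<open>a\<close> lives on a one-dimensional quotient. This removes an obstruction in
  the case \<open>r = 2\<close> below.\<close>

lemma alternating_planar_rank_one:
  assumes A: "A \<in> SGL n" and B: "B \<in> SGL n" and C: "invop n (mv n A) C"
    and alt: "\<And>\<xi>. \<xi> \<in> bvecs n \<Longrightarrow> dot n \<xi> (sumop n A B \<xi>) = 0"
    and card: "card (sumop n A B ` bvecs n) = 4"
    and d: "d \<in> sumop n A B ` bvecs n" "d \<noteq> 0"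
      "\<And>\<xi>. \<xi> \<in> bvecs n \<Longrightarrow> dot n d \<xi> = dot n (sumop n A B \<xi>) (C (sumop n A B \<xi>))"
  shows "rank_one_on (sumop n A B ` bvecs n) (\<lambda>u v. dot n u (C v))"
proof -
  define S where "S = sumop n A B"
  define U where "U = S ` bvecs n"
  define a where "a = (\<lambda>u v. dot n u (C v))"
  have S: "symop n S" unfolding S_def by (rule symop_sumop[OF A B])
  note S' = symopD[OF S]
  have U: "subsp U" unfolding U_def by (rule subsp_image[OF S])
  have UV: "U \<subseteq> bvecs n" using S' by (auto simp: U_def)
  have a: "sym_form U a" unfolding a_def by (rule invop_form[OF C UV])
  obtain \<zeta> where z: "\<zeta> \<in> bvecs n" "d = S \<zeta>" using d(1) by (auto simp: S_def)
  have dU: "d \<in> U" using d(1) by (simp add: U_def S_def)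
  have zd: "dot n \<zeta> d = 0" using alt[OF z(1)] z by (simp add: S_def)
  have "dot n d \<zeta> = a d d" using d(3)[OF z(1)] z by (simp add: S_def a_def)
  then have dd: "a d d = 0" using zd by (simp add: dot_commute)
  obtain \<eta> where e: "\<eta> \<in> bvecs n" "dot n d \<eta> = 1"
    using dot_nondeg[of d n] d(2) dU UV bit_not_zero_iff by blast
  define v where "v = S \<eta>"
  have vU: "v \<in> U" using e by (simp add: v_def U_def)
  have vv: "a v v = 1" using d(3)[OF e(1)] e(2) by (simp add: v_def S_def a_def)
  have v0: "v \<noteq> 0" using vv by (auto simp: a_def)
  have "d \<noteq> v" using dd vv by auto
  then have Ueq: "U = {0, d, v, d + v}"
    using card dU vU d(2) v0 by (intro subsp_four_elements[OF U]) (auto simp: U_def S_def)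
  have seq: "img_form n S d w = dot n \<zeta> w" if "w \<in> U" for w
    using img_form_eq[OF S z(1)] that z by (simp add: U_def)
  have zv: "dot n \<zeta> v = 1" using S'(3)[OF z(1) e(1)] e(2) z by (simp add: v_def)
  have dv: "a d v = 0"
  proof (rule ccontr)
    assume "a d v \<noteq> 0"
    then have 1: "a d v = 1" by simp
    have "img_form n S d w + a d w = 0" if w: "w \<in> U" for w
    proof -
      have "dot n \<zeta> w = a d w"
        using w sym_form_add_right[OF a dU dU vU] zd zv dd 1 lin_on_0[OF U sym_formD(1)[OF a dU]]
        unfolding Ueq by (auto simp: dot_add_right)
      then show ?thesis using seq[OF w] by simp
    qed
    then show False
      using nondeg_sum_form[OF A B C] dU d(2) unfolding nondeg_def U_def S_def a_def by blast
  qed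
  have d0: "a d w = 0" if "w \<in> U" for w
    using that dd dv sym_form_add_right[OF a dU dU vU] lin_on_0[OF U sym_formD(1)[OF a dU]]
    unfolding Ueq by auto
  have z0: "a 0 w = 0" if "w \<in> U" for w using sym_form_0_left[OF U a that] .
  have v1: "a v w = a w w" if "w \<in> U" for w
    using that vv dd d0[OF vU] sym_formD(2)[OF a dU vU] lin_onD[OF sym_form_diag[OF U a] dU vU]
      sym_form_add_right[OF a vU dU vU] lin_on_0[OF U sym_formD(1)[OF a vU]]
      z0[OF subspD(2)[OF U]]
    unfolding Ueq by auto
  have "a u w = a u u * a w w" if u: "u \<in> U" and w: "w \<in> U" for u w
  proof -
    have "a (d + v) w = a w w" using sym_form_add_left[OF U a dU vU w] d0[OF w] v1[OF w] by simp
    moreover have "a (d + v) (d + v) = 1"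
      using lin_onD[OF sym_form_diag[OF U a] dU vU] dd vv by simp
    moreover have "u = 0 \<or> u = d \<or> u = v \<or> u = d + v" using u Ueq by blast
    moreover have "a 0 0 = 0" using z0 subspD(2)[OF U] by blast
    ultimately show ?thesis using d0[OF w] z0[OF w] v1[OF w] dd vv by (elim disjE) simp_all
  qed
  then have "rank_one_on U a" using vU vv unfolding rank_one_on_def by blast
  then show ?thesis by (simp add: U_def S_def a_def)
qed

text \<open>The extra vector \<open>y\<close> is taken in \<open>U\<close>: isotropy for the inverse
  of \<open>B\<close> keeps the matrix invertible, \<open>y \<noteq> 0\<close> makes the first form
  non-alternating, and failure of \<open>P y\<close> does so for the second. At least half of
  \<open>U\<close> is isotropic, and at most two vectors are excluded.\<close>

lemma alternating_walk:
  assumes A: "A \<in> SGL n" and B: "B \<in> SGL n" and C: "invop n (mv n A) C"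
    and alt: "\<And>\<xi>. \<xi> \<in> bvecs n \<Longrightarrow> dot n \<xi> (sumop n A B \<xi>) = 0"
    and card: "card (sumop n A B ` bvecs n) = 2 ^ r" and r: "even r" "r > 0"
    and nr: "\<not> rank_one_on (sumop n A B ` bvecs n) (\<lambda>u v. dot n u (C v))"
  shows "gamma_walk n (r + 1) A B"
proof -
  define S where "S = sumop n A B"
  define U where "U = S ` bvecs n"
  define a where "a = (\<lambda>u v. dot n u (C v))"
  have S: "symop n S" unfolding S_def by (rule symop_sumop[OF A B])
  note S' = symopD[OF S]
  have U: "subsp U" unfolding U_def by (rule subsp_image[OF S])
  have UV: "U \<subseteq> bvecs n" using S' by (auto simp: U_def)
  obtain D where D: "invop n (mv n B) D" using SGL_obtain_inverse[OF B] .
  define K where "K = {y \<in> U. dot n y (D y) = 0}"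
  have lg: "lin_on U (\<lambda>y. dot n y (D y))" by (rule sym_form_diag[OF U invop_form[OF D UV]])
  have cK: "2 * card K \<ge> 2 ^ r"
  proof (cases "\<exists>u\<in>U. dot n u (D u) = 1")
    case True
    then have "2 * card K = card U" unfolding K_def using card_half(1)[OF U lg] by blast
    then show ?thesis using card by (simp add: U_def S_def)
  next
    case False
    then have "K = U" by (auto simp: K_def)
    then show ?thesis using card by (simp add: U_def S_def)
  qed
  \<comment> \<open>\<open>P y\<close> says that \<open>y\<close> represents the diagonal of
    \<open>a\<close> pulled back along \<open>S\<close>; for such \<open>y\<close> in
    \<open>U\<close> the second form after the step would be alternating.\<close>
  define P where "P y \<longleftrightarrow> (\<forall>\<xi>\<in>bvecs n. dot n y \<xi> = a (S \<xi>) (S \<xi>))" for y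
  define E where "E = insert 0 {y \<in> U. P y}"
  have uniq: "x = y" if "P x" "P y" "x \<in> U" "y \<in> U" for x y
    using that UV by (intro dot_eqI[of x n y]) (auto simp: P_def)
  have finE: "finite E" using subspD(1)[OF U] by (simp add: E_def)
  have cE: "card E \<le> 2"
  proof (cases "\<exists>d\<in>U. P d")
    case True
    then obtain d where "d \<in> U" "P d" by blast
    then have "{y \<in> U. P y} = {d}" using uniq by blast
    then show ?thesis by (simp add: E_def card_insert_if)
  next
    case False
    then have "{y \<in> U. P y} = {}" by blast
    then show ?thesis by (simp only: E_def) simp
  qed
  have "card E < card K"
  proof (cases "r = 2")
    case True
    have "d = 0" if "d \<in> U" "P d" for d
    proof (rule ccontr)
      assume "d \<noteq> 0"
      then show False
        using alternating_planar_rank_one[OF A B C alt, of d] nr card True that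
        by (simp add: P_def U_def S_def a_def)
    qed
    then have "E = {0}" by (auto simp: E_def)
    then show ?thesis using cK True by simp
  next
    case False
    then have "r \<ge> 4" using r by (auto elim!: evenE)
    then have "(2::nat) ^ 4 \<le> 2 ^ r" by (intro power_increasing) auto
    then show ?thesis using cK cE by simp
  qed
  then obtain y where y: "y \<in> K" "y \<notin> E" using obtain_outside[OF finE] by blast
  have yU: "y \<in> U" and yV: "y \<in> bvecs n" and y0: "y \<noteq> 0" and iso: "dot n y (D y) = 0"
    using y UV by (auto simp: K_def E_def)
  have nP: "\<not> P y" using y yU by (auto simp: E_def)
  obtain \<zeta> where z: "\<zeta> \<in> bvecs n" "y = S \<zeta>" using yU by (auto simp: U_def)
  have zy: "dot n y \<zeta> = 0" using alt[OF z(1)] z by (simp add: S_def dot_commute)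
  define B' where "B' = B + outer n y"
  have B': "B' \<in> SGL n" unfolding B'_def by (rule SGL_add_outer_isotropic[OF B D yV iso])
  define T where "T = sumop n A B'"
  have T: "T v = S v + scal (dot n y v) y" for v
    unfolding T_def B'_def S_def by (rule sumop_add_outer[OF B yV])
  have T1: "T v = S (v + scal (dot n y v) \<zeta>)" if "v \<in> bvecs n" for v
    using that z S'(2) by (simp add: T symop_scal[OF S])
  \<comment> \<open>Because \<open>dot n y \<zeta> = 0\<close>, the map
    \<open>v \<mapsto> v + scal (dot n y v) \<zeta>\<close> is an involution that exchanges
    \<open>S\<close> and \<open>T\<close>; hence the two have the same image.\<close>
  have T2: "T (v + scal (dot n y v) \<zeta>) = S v" if "v \<in> bvecs n" for v
    using T1[of "v + scal (dot n y v) \<zeta>"] that z zy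
    by (simp add: dot_add_right dot_scal add.assoc)
  have im: "T ` bvecs n = U"
  proof
    show "T ` bvecs n \<subseteq> U" using T1 z by (auto simp: U_def)
    show "U \<subseteq> T ` bvecs n"
    proof
      fix u assume "u \<in> U"
      then obtain v where "v \<in> bvecs n" "u = S v" by (auto simp: U_def)
      then show "u \<in> T ` bvecs n" using T2[of v] z by (intro image_eqI[of _ _ "v + scal (dot n y v) \<zeta>"]) auto
    qed
  qed
  have "gamma_walk n r A B'"
  proof (rule walk_of_rank_length[OF A C B', folded T_def])
    show "card (T ` bvecs n) = 2 ^ r" using im card by (simp add: U_def S_def)
    show "\<not> rank_one_on (T ` bvecs n) (\<lambda>u v. dot n u (C v))" using im nr by (simp add: U_def S_def)
    obtain \<xi> where x: "\<xi> \<in> bvecs n" "dot n y \<xi> = 1"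
      using dot_nondeg[OF yV] y0 bit_not_zero_iff by blast
    have "dot n \<xi> (T \<xi>) = 1"
      using x alt[OF x(1)] by (simp add: T S_def dot_add_right dot_commute[of n \<xi> y])
    then show "\<exists>\<xi>\<in>bvecs n. dot n \<xi> (T \<xi>) = 1" using x by blast
    obtain \<eta> where e: "\<eta> \<in> bvecs n" "dot n y \<eta> \<noteq> a (S \<eta>) (S \<eta>)" using nP by (auto simp: P_def)
    define \<theta> where "\<theta> = \<eta> + scal (dot n y \<eta>) \<zeta>"
    have "T \<theta> = S \<eta>" unfolding \<theta>_def by (rule T2[OF e(1)])
    moreover have "dot n \<theta> (S \<eta>) = dot n y \<eta>"
      using alt[OF e(1)] S'(3)[OF z(1) e(1)] z by (simp add: \<theta>_def dot_add_left dot_scal S_def)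
    ultimately have "dot n \<theta> (T \<theta>) + dot n (T \<theta>) (C (T \<theta>)) = 1"
      using e(2) by (simp add: a_def bit_add_eq_1_iff del: bit_not_zero_iff bit_not_one_iff)
    moreover have "\<theta> \<in> bvecs n" using e z by (simp add: \<theta>_def)
    ultimately show "\<exists>\<xi>\<in>bvecs n. dot n \<xi> (T \<xi>) + dot n (T \<xi>) (C (T \<xi>)) = 1" by blast
  qed
  moreover have "gamma_adj n B' B"
    unfolding B'_def by (rule gamma_adj_outer'[OF B _ yV y0]) (use B' B'_def in simp)
  ultimately show ?thesis using gamma_walk_snoc by simp
qed

text \<open>The image of a self-adjoint operator is the annihilator of its kernel: if
  \<open>z\<close> annihilates the kernel, pairing with \<open>z\<close> descends to a functional on
  the image, whose representative there is \<open>z\<close> itself.\<close>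

lemma kernel_separates:
  assumes S: "symop n S" and z: "z \<in> bvecs n" "z \<notin> S ` bvecs n"
  shows "\<exists>\<eta>\<in>bvecs n. S \<eta> = 0 \<and> dot n z \<eta> = 1"
proof (rule ccontr)
  assume "\<not> ?thesis"
  then have ker: "dot n z \<eta> = 0" if "\<eta> \<in> bvecs n" "S \<eta> = 0" for \<eta>
    using that bit_not_zero_iff by blast
  note S' = symopD[OF S]
  define \<phi> where "\<phi> u = dot n z (SOME \<xi>. \<xi> \<in> bvecs n \<and> S \<xi> = u)" for u
  have phi: "\<phi> (S \<xi>) = dot n z \<xi>" if x: "\<xi> \<in> bvecs n" for \<xi>
  proof -
    define \<zeta> where "\<zeta> = (SOME \<zeta>. \<zeta> \<in> bvecs n \<and> S \<zeta> = S \<xi>)"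
    have "\<zeta> \<in> bvecs n" "S \<zeta> = S \<xi>"
      unfolding \<zeta>_def using someI[of "\<lambda>\<zeta>. \<zeta> \<in> bvecs n \<and> S \<zeta> = S \<xi>" \<xi>] x by auto
    then have "dot n z (\<zeta> + \<xi>) = 0" using S'(2)[of \<zeta> \<xi>] x by (intro ker) auto
    then show ?thesis by (simp add: \<phi>_def \<zeta>_def dot_add_right)
  qed
  have "lin_on (S ` bvecs n) \<phi>" unfolding lin_on_def
  proof (intro ballI)
    fix u v assume "u \<in> S ` bvecs n" "v \<in> S ` bvecs n"
    then obtain \<xi> \<eta> where "\<xi> \<in> bvecs n" "u = S \<xi>" "\<eta> \<in> bvecs n" "v = S \<eta>" by blast
    then show "\<phi> (u + v) = \<phi> u + \<phi> v"
      using phi[of "\<xi> + \<eta>"] phi[of \<xi>] phi[of \<eta>] S'(2)[of \<xi> \<eta>] by (simp add: dot_add_right)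
  qed
  then obtain w where w: "w \<in> S ` bvecs n" "\<forall>u\<in>S ` bvecs n. img_form n S w u = \<phi> u"
    using nondeg_represents[OF subsp_image[OF S] sym_form_img[OF S] nondeg_img[OF S]] by blast
  obtain \<omega> where o: "\<omega> \<in> bvecs n" "w = S \<omega>" using w by blast
  have "z = w"
  proof (rule dot_eqI[OF z(1)])
    fix \<xi> assume x: "\<xi> \<in> bvecs n"
    have "dot n z \<xi> = img_form n S w (S \<xi>)" using phi[OF x] w(2) x by simp
    also have "\<dots> = dot n \<omega> (S \<xi>)" using img_form_eq[OF S o(1)] o x by simp
    finally show "dot n z \<xi> = dot n w \<xi>" using S'(3)[OF o(1) x] o by simp
  qed (use o S' in auto)
  then show False using z w by simp
qed

text \<open>The extra vector \<open>z\<close> is taken outside \<open>U\<close>, with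
  \<open>a u0 z = 1\<close> for some \<open>u0\<close> in the radical of \<open>a\<close> on
  \<open>U\<close>; this destroys rank one and raises the dimension to \<open>r + 1\<close>.\<close>

lemma alternating_walk_rank_one:
  assumes A: "A \<in> SGL n" and B: "B \<in> SGL n" and C: "invop n (mv n A) C"
    and alt: "\<And>\<xi>. \<xi> \<in> bvecs n \<Longrightarrow> dot n \<xi> (sumop n A B \<xi>) = 0"
    and card: "card (sumop n A B ` bvecs n) = 2 ^ r" and r: "r \<ge> 2"
    and r1: "rank_one_on (sumop n A B ` bvecs n) (\<lambda>u v. dot n u (C v))"
  shows "gamma_walk n (r + 2) A B"
proof -
  define S where "S = sumop n A B"
  define U where "U = S ` bvecs n"
  define a where "a = (\<lambda>u v. dot n u (C v))"
  have S: "symop n S" unfolding S_def by (rule symop_sumop[OF A B])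
  note S' = symopD[OF S] and C' = symopD[OF invop_symop_inverse[OF C]]
  have U: "subsp U" unfolding U_def by (rule subsp_image[OF S])
  have UV: "U \<subseteq> bvecs n" using S' by (auto simp: U_def)
  have a: "sym_form U a" unfolding a_def by (rule invop_form[OF C UV])
  have rU: "rank_one_on U a" using r1 by (simp add: U_def S_def a_def)
  obtain D where D: "invop n (mv n B) D" using SGL_obtain_inverse[OF B] .
  obtain p where p: "p \<in> U" "a p p = 1" using rU unfolding rank_one_on_def by blast
  have pV: "p \<in> bvecs n" using p UV by blast
  \<comment> \<open>This is \<open>B (C p)\<close>, so \<open>D u1 = C p\<close> and alternation
    gives \<open>dot n u1 (D u1) = a p p = 1\<close>. Since \<open>a u0 u1 = 0\<close>, the two
    functionals to be separated by \<open>z\<close> differ.\<close>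
  define u1 where "u1 = p + S (C p)"
  have Cp: "C p \<in> bvecs n" using C' pV by blast
  have u1U: "u1 \<in> U" using p Cp subspD(3)[OF U] by (auto simp: u1_def U_def)
  have u1V: "u1 \<in> bvecs n" using u1U UV by blast
  have "u1 = mv n B (C p)"
    using invopD(3)[OF C pV] by (simp add: u1_def S_def sumop_def)
  then have "D u1 = C p" using invopD(4)[OF D Cp] by simp
  then have g1: "dot n u1 (D u1) = 1"
    using p(2) alt[OF Cp] by (simp add: u1_def dot_add_left a_def S_def dot_commute[of n "sumop n A B (C p)"])
  have "2 * card {u \<in> U. a u u = 0} = 2 ^ r"
    using card_half(1)[OF U sym_form_diag[OF U a] p(1)] p(2) card by (simp add: U_def S_def)
  moreover have "(2::nat) ^ 2 \<le> 2 ^ r" using r by (intro power_increasing) auto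
  ultimately have "card {0::nat \<Rightarrow> bit} < card {u \<in> U. a u u = 0}" by simp
  then obtain u0 where u0: "u0 \<in> U" "a u0 u0 = 0" "u0 \<noteq> 0"
    using obtain_outside[of "{0::nat \<Rightarrow> bit}" "{u \<in> U. a u u = 0}"] by auto
  have u0V: "u0 \<in> bvecs n" using u0 UV by blast
  have h0: "a u0 u = 0" if "u \<in> U" for u
    using rank_one_onD[OF rU u0(1) that] u0(2) by simp
  have aV: "sym_form (bvecs n) a" unfolding a_def by (rule invop_form[OF C]) simp
  have gV: "lin_on (bvecs n) (\<lambda>v. dot n v (D v))"
    by (rule sym_form_diag[OF subsp_bvecs invop_form[OF D]]) simp
  have "C u0 \<noteq> 0" using invopD(3)[OF C u0V] symop_zero[OF invopD(1)[OF C]] u0(3) by auto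
  then obtain v where "v \<in> bvecs n" "dot n (C u0) v = 1"
    using dot_nondeg[OF C'(1)[OF u0V]] bit_not_zero_iff by blast
  then have "\<exists>v\<in>bvecs n. a u0 v = 1" using C'(3)[OF u0V] by (auto simp: a_def)
  moreover have "\<exists>v\<in>bvecs n. a u0 v \<noteq> dot n v (D v)" using h0[OF u1U] g1 u1V by force
  ultimately obtain z where z: "z \<in> bvecs n" "a u0 z = 1" "dot n z (D z) = 0"
    using separate_functionals[OF subsp_bvecs sym_formD(1)[OF aV u0V] gV] by blast
  have zU: "z \<notin> U" using h0 z(2) by auto
  have z0: "z \<noteq> 0" using zU subspD(2)[OF U] by auto
  \<comment> \<open>A kernel vector of \<open>S\<close> that \<open>T\<close> sends to
    \<open>z\<close>; adding it corrects preimages under \<open>S\<close> to preimages under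
    \<open>T\<close>.\<close>
  obtain \<eta> where e: "\<eta> \<in> bvecs n" "S \<eta> = 0" "dot n z \<eta> = 1"
    using kernel_separates[OF S z(1)] zU by (auto simp: U_def)
  define B' where "B' = B + outer n z"
  have B': "B' \<in> SGL n" unfolding B'_def by (rule SGL_add_outer_isotropic[OF B D z(1,3)])
  define T where "T = sumop n A B'"
  have T: "T v = S v + scal (dot n z v) z" for v
    unfolding T_def B'_def S_def by (rule sumop_add_outer[OF B z(1)])
  have Te: "T \<eta> = z" using e by (simp add: T)
  have T2: "T (v + scal (dot n z v) \<eta>) = S v" if "v \<in> bvecs n" for v
    using that e by (simp add: T dot_add_right dot_scal S'(2) symop_scal[OF S])
  have Tsym: "symop n T" unfolding T_def by (rule symop_sumop[OF A B'])
  have UT: "U \<subseteq> T ` bvecs n"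
  proof
    fix u assume "u \<in> U"
    then obtain v where "v \<in> bvecs n" "u = S v" by (auto simp: U_def)
    then show "u \<in> T ` bvecs n" using T2[of v] e by (intro image_eqI[of _ _ "v + scal (dot n z v) \<eta>"]) auto
  qed
  have zT: "z \<in> T ` bvecs n" using Te e(1) by (intro image_eqI[of _ _ \<eta>]) auto
  have im: "T ` bvecs n = U \<union> (\<lambda>u. u + z) ` U"
  proof
    show "T ` bvecs n \<subseteq> U \<union> (\<lambda>u. u + z) ` U"
    proof (rule image_subsetI)
      fix v assume "v \<in> bvecs n"
      then show "T v \<in> U \<union> (\<lambda>u. u + z) ` U" by (cases "dot n z v") (auto simp: T U_def)
    qed
    show "U \<union> (\<lambda>u. u + z) ` U \<subseteq> T ` bvecs n"
      using UT zT subspD(3)[OF subsp_image[OF Tsym]] by blast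
  qed
  have "gamma_walk n (r + 1) A B'"
  proof (rule walk_of_rank_length[OF A C B', folded T_def])
    have "U \<inter> (\<lambda>u. u + z) ` U = {}"
    proof -
      have False if "u \<in> U" "u + z \<in> U" for u
        using subspD(3)[OF U that] zU by simp
      then show ?thesis by blast
    qed
    moreover have "card ((\<lambda>u. u + z) ` U) = card U" by (rule card_image) (auto simp: inj_on_def)
    ultimately have "card (T ` bvecs n) = 2 * card U"
      unfolding im using subspD(1)[OF U] by (simp add: card_Un_disjoint)
    then show "card (T ` bvecs n) = 2 ^ (r + 1)" using card by (simp add: U_def S_def)
    have "dot n \<eta> (T \<eta>) = 1" using Te e(3) by (simp add: dot_commute)
    then show "\<exists>\<xi>\<in>bvecs n. dot n \<xi> (T \<xi>) = 1" using e(1) by blast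
    obtain \<pi> where pi: "\<pi> \<in> bvecs n" "p = S \<pi>" using p by (auto simp: U_def)
    \<comment> \<open>A \<open>T\<close>-preimage of \<open>p\<close> with first form value 0, so
      that \<open>a p p = 1\<close> makes the second form non-alternating.\<close>
    define \<theta> where "\<theta> = \<pi> + scal (dot n z \<pi>) \<eta>"
    have "T \<theta> = p" unfolding \<theta>_def using T2[OF pi(1)] pi by simp
    moreover have "dot n \<theta> p = 0"
      using alt[OF pi(1)] S'(3)[OF e(1) pi(1)] pi e(2) by (simp add: \<theta>_def dot_add_left dot_scal S_def)
    ultimately have "dot n \<theta> (T \<theta>) + dot n (T \<theta>) (C (T \<theta>)) = 1" using p by (simp add: a_def)
    moreover have "\<theta> \<in> bvecs n" using pi e by (simp add: \<theta>_def)
    ultimately show "\<exists>\<xi>\<in>bvecs n. dot n \<xi> (T \<xi>) + dot n (T \<xi>) (C (T \<xi>)) = 1" by blast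
    show "\<not> rank_one_on (T ` bvecs n) (\<lambda>u v. dot n u (C v))"
    proof
      assume "rank_one_on (T ` bvecs n) (\<lambda>u v. dot n u (C v))"
      then have "rank_one_on (T ` bvecs n) a" by (simp add: a_def)
      then have "a u0 z = a u0 u0 * a z z" using rank_one_onD u0(1) UT zT by blast
      then show False using u0 z by simp
    qed
  qed
  moreover have "gamma_adj n B' B"
    unfolding B'_def by (rule gamma_adj_outer'[OF B _ z(1) z0]) (use B' B'_def in simp)
  ultimately show ?thesis using gamma_walk_snoc[of n "r + 1" A B' B] by simp
qed

section \<open>Lower bounds and the distance\<close>

definition lincomb_bits :: "nat \<Rightarrow> (nat \<Rightarrow> nat \<Rightarrow> bit) \<Rightarrow> (nat \<Rightarrow> bit) \<Rightarrow> nat \<Rightarrow> bit" where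
  "lincomb_bits k y c = (\<Sum>i<k. scal (c i) (y i))"

lemma sum_fun_apply: "(\<Sum>i\<in>I. f i) j = (\<Sum>i\<in>I. f i j)"
  for f :: "'i \<Rightarrow> 'b \<Rightarrow> 'c::comm_monoid_add"
  by (induction I rule: infinite_finite_induct) auto

lemma sum_bvecs: "(\<And>i. i < k \<Longrightarrow> y i \<in> bvecs n) \<Longrightarrow> (\<Sum>i<k. y i) \<in> bvecs n"
  by (auto simp: bvecs_def sum_fun_apply)

lemma lincomb_bits_closed: "(\<And>i. i < k \<Longrightarrow> y i \<in> bvecs n) \<Longrightarrow> lincomb_bits k y c \<in> bvecs n"
  unfolding lincomb_bits_def by (intro sum_bvecs) auto

lemma dot_sum_left: "dot n (\<Sum>i\<in>I. f i) v = (\<Sum>i\<in>I. dot n (f i) v)"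
  by (induction I rule: infinite_finite_induct) (simp_all only: sum.infinite sum.empty sum.insert dot_zero dot_add_left simp_thms)

lemma dot_sum_right: "dot n v (\<Sum>i\<in>I. f i) = (\<Sum>i\<in>I. dot n v (f i))"
  by (induction I rule: infinite_finite_induct) (simp_all only: sum.infinite sum.empty sum.insert dot_zero dot_add_right simp_thms)

lemma lin_on_sum:
  fixes k :: nat
  assumes "lin_on (bvecs n) f" "\<And>i. i < k \<Longrightarrow> y i \<in> bvecs n"
  shows "f (\<Sum>i<k. y i) = (\<Sum>i<k. f (y i))"
  using assms(2)
proof (induction k)
  case 0
  then show ?case using lin_on_0[OF subsp_bvecs assms(1)] by (simp only: lessThan_0 sum.empty)
next
  case (Suc k)
  have "f ((\<Sum>i<k. y i) + y k) = f (\<Sum>i<k. y i) + f (y k)"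
    using Suc.prems by (intro lin_onD[OF assms(1) sum_bvecs]) auto
  then show ?case using Suc by (simp only: sum.lessThan_Suc less_Suc_eq simp_thms)
qed

lemma lin_on_scal: "lin_on (bvecs n) f \<Longrightarrow> f (scal c v) = c * f v"
  using lin_on_0[OF subsp_bvecs] by (cases c) auto

lemma lin_on_lincomb:
  assumes "lin_on (bvecs n) f" "\<And>i. i < k \<Longrightarrow> y i \<in> bvecs n"
  shows "f (lincomb_bits k y c) = (\<Sum>i<k. c i * f (y i))"
  unfolding lincomb_bits_def
  using lin_on_sum[OF assms(1), of k "\<lambda>i. scal (c i) (y i)"] assms by (simp add: lin_on_scal)

lemma lincomb_unit:
  assumes "i < k" shows "lincomb_bits k y (\<lambda>j. of_bool (j = i)) = y i"
proof -
  have "lincomb_bits k y (\<lambda>j. of_bool (j = i)) = (\<Sum>j<k. if j = i then y i else 0)"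
    unfolding lincomb_bits_def by (rule sum.cong) auto
  then show ?thesis using assms by simp
qed

lemma unit_bvecs: "i < k \<Longrightarrow> (\<lambda>j. of_bool (j = i)) \<in> bvecs k"
  by (auto simp: bvecs_def)

text \<open>Bits are their own squares, so the quadratic expression at \<open>v\<close> equals the
  pairing of \<open>v\<close> with the sum of the \<open>y i\<close>.\<close>

lemma alternating_sum_eq_0:
  assumes "\<And>i. i < k \<Longrightarrow> y i \<in> bvecs n"
    and "\<And>v. v \<in> bvecs n \<Longrightarrow> dot n v (\<Sum>i<k. scal (dot n (y i) v) (y i)) = 0"
  shows "(\<Sum>i<k. y i) = 0"
proof (rule dot_nondeg[OF sum_bvecs[OF assms(1)]])
  fix v assume "v \<in> bvecs n"
  then show "dot n (\<Sum>i<k. y i) v = 0"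
    using assms(2)[of v] by (simp add: dot_sum_left dot_sum_right dot_scal dot_commute[of n v])
qed

text \<open>Eliminating the dependent vector \<open>y m\<close> shows that the image lies in the
  span of the first \<open>m\<close> vectors. The value 0 beyond \<open>m\<close> keeps the
  coefficients in \<open>bvecs m\<close>.\<close>

lemma sum_outer_lincomb:
  assumes "y m = (\<Sum>i<m. y i)"
  shows "(\<Sum>i<Suc m. scal (dot n (y i) v) (y i)) =
    lincomb_bits m y (\<lambda>i. if i < m then dot n (y i) v + dot n (y m) v else 0)"
proof -
  have "scal (dot n (y m) v) (y m) = (\<Sum>i<m. scal (dot n (y m) v) (y i))"
    using assms by (cases "dot n (y m) v") (simp_all flip: zero_fun_def)
  then have "(\<Sum>i<Suc m. scal (dot n (y i) v) (y i)) =
      (\<Sum>i<m. scal (dot n (y i) v) (y i) + scal (dot n (y m) v) (y i))"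
    by (simp add: sum.distrib)
  also have "\<dots> = lincomb_bits m y (\<lambda>i. if i < m then dot n (y i) v + dot n (y m) v else 0)"
    unfolding lincomb_bits_def by (intro sum.cong) (auto simp: scal_def fun_eq_iff distrib_right)
  finally show ?thesis .
qed

text \<open>Independence makes the pairing of coefficient vectors with \<open>bvecs n\<close>
  nondegenerate on the left, so \<open>functional_represented\<close> applies; unit coefficient
  vectors give the single equations.\<close>

lemma independent_prescribed_dot:
  assumes y: "\<And>i. i < r \<Longrightarrow> y i \<in> bvecs n"
    and ind: "\<And>c. c \<in> bvecs r \<Longrightarrow> lincomb_bits r y c = 0 \<Longrightarrow> c = 0"
  shows "\<exists>\<xi>\<in>bvecs n. \<forall>i<r. dot n (y i) \<xi> = t i"
proof -
  have "\<exists>\<xi>\<in>bvecs n. \<forall>c\<in>bvecs r. dot n (lincomb_bits r y c) \<xi> = dot r t c"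
  proof (rule functional_represented[OF subsp_bvecs subsp_bvecs])
    show "lin_on (bvecs r) (\<lambda>c. dot n (lincomb_bits r y c) \<xi>)" for \<xi>
      by (simp add: lin_on_def lincomb_bits_def dot_sum_left dot_scal distrib_right sum.distrib)
    show "c = 0" if "c \<in> bvecs r" "\<And>\<xi>. \<xi> \<in> bvecs n \<Longrightarrow> dot n (lincomb_bits r y c) \<xi> = 0" for c
      by (rule ind[OF that(1)], rule dot_nondeg[OF lincomb_bits_closed[OF y]]) (use that(2) in auto)
  qed (auto simp: lin_on_def dot_add_right)
  then obtain \<xi> where x: "\<xi> \<in> bvecs n" "\<And>c. c \<in> bvecs r \<Longrightarrow> dot n (lincomb_bits r y c) \<xi> = dot r t c"
    by blast
  have "dot n (y i) \<xi> = t i" if "i < r" for i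
    using x(2)[OF unit_bvecs[OF that]] lincomb_unit[OF that, of y] that
    by (simp add: dot_def of_bool_def if_distrib cong: if_cong)
  then show ?thesis using x(1) by blast
qed

text \<open>Since \<open>r\<close> is even, the system \<open>c i = t i + (\<Sum>j<r. t j)\<close> is solved by \<open>t i = c i + (\<Sum>j<r. c j)\<close>.\<close>

lemma image_alternating_sum:
  assumes y: "\<And>i. i < r \<Longrightarrow> y i \<in> bvecs n" and yr: "y r = (\<Sum>i<r. y i)" and r: "even r"
    and ind: "\<And>c. c \<in> bvecs r \<Longrightarrow> lincomb_bits r y c = 0 \<Longrightarrow> c = 0"
  shows "(\<lambda>v. \<Sum>i<Suc r. scal (dot n (y i) v) (y i)) ` bvecs n = lincomb_bits r y ` bvecs r"
    (is "?S ` _ = _")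
proof
  show "?S ` bvecs n \<subseteq> lincomb_bits r y ` bvecs r"
    unfolding sum_outer_lincomb[OF yr] by (auto simp: bvecs_def)
  show "lincomb_bits r y ` bvecs r \<subseteq> ?S ` bvecs n"
  proof (rule image_subsetI)
    fix c :: "nat \<Rightarrow> bit" assume c: "c \<in> bvecs r"
    define \<sigma> where "\<sigma> = (\<Sum>i<r. c i)"
    have "\<exists>\<xi>\<in>bvecs n. \<forall>i<r. dot n (y i) \<xi> = c i + \<sigma>"
      by (rule independent_prescribed_dot[OF y ind])
    then obtain \<xi> where x: "\<xi> \<in> bvecs n" "\<forall>i<r. dot n (y i) \<xi> = c i + \<sigma>" by blast
    have "(\<Sum>i<r. \<sigma>) = 0" using r by (auto elim!: evenE)
    moreover have "dot n (y r) \<xi> = (\<Sum>i<r. c i + \<sigma>)" using x(2) by (simp add: yr dot_sum_left)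
    ultimately have "dot n (y r) \<xi> = \<sigma>" by (simp add: sum.distrib \<sigma>_def)
    then have "(\<lambda>i. if i < r then dot n (y i) \<xi> + dot n (y r) \<xi> else 0) = c"
      using x(2) c by (auto simp: fun_eq_iff bvecs_def add.assoc)
    then have e: "?S \<xi> = lincomb_bits r y c" using sum_outer_lincomb[OF yr, of n \<xi>] by simp
    show "lincomb_bits r y c \<in> ?S ` bvecs n" by (rule image_eqI[OF _ x(1)]) (simp only: e)
  qed
qed

lemma card_lincomb_image:
  assumes ind: "\<And>c. c \<in> bvecs r \<Longrightarrow> lincomb_bits r y c = 0 \<Longrightarrow> c = 0"
  shows "card (lincomb_bits r y ` bvecs r) = 2 ^ r"
proof -
  have add: "lincomb_bits r y (c + d) = lincomb_bits r y c + lincomb_bits r y d" for c d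
    unfolding lincomb_bits_def sum.distrib[symmetric]
    by (intro sum.cong) (auto simp: scal_def fun_eq_iff distrib_right)
  have "inj_on (lincomb_bits r y) (bvecs r)"
  proof (rule inj_onI)
    fix c d assume cd: "c \<in> bvecs r" "d \<in> bvecs r" "lincomb_bits r y c = lincomb_bits r y d"
    then have "c + d = 0" using ind[of "c + d"] by (simp add: add)
    then show "c = d" by (simp add: vec_add_eq_0_iff)
  qed
  then show ?thesis by (simp add: card_image card_bvecs)
qed

section \<open>Lower bounds for walk lengths\<close>

lemma gamma_walk_steps:
  assumes "gamma_walk n k A B"
  obtains p y where "p k = B" "\<And>i. i \<le> k \<Longrightarrow> p i \<in> SGL n" "\<And>i. i < k \<Longrightarrow> y i \<in> bvecs n"
    "\<And>i v. i \<le> k \<Longrightarrow> mv n (p i) v = mv n A v + (\<Sum>j<i. scal (dot n (y j) v) (y j))"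
proof -
  obtain p where p: "p 0 = A" "p k = B" "\<forall>i\<le>k. p i \<in> SGL n" "\<forall>i<k. gamma_adj n (p i) (p (Suc i))"
    using assms by (auto simp: gamma_walk_def)
  have "\<exists>y. y \<in> bvecs n \<and> p (Suc i) = p i + outer n y" if "i < k" for i
    using p that gamma_adj_iff[of "p i" n "p (Suc i)"] by auto
  then obtain y where y: "\<And>i. i < k \<Longrightarrow> y i \<in> bvecs n" "\<And>i. i < k \<Longrightarrow> p (Suc i) = p i + outer n (y i)"
    by metis
  have "mv n (p i) v = mv n A v + (\<Sum>j<i. scal (dot n (y j) v) (y j))" if "i \<le> k" for i v
    using that
  proof (induction i)
    case 0
    then show ?case using p(1) by (simp flip: zero_fun_def)
  next
    case (Suc i)
    then show ?case
      using y[of i] p(3) SGL_D(1)[of "p i" n] by (simp add: mv_add_mat mv_outer add.assoc)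
  qed
  then show ?thesis using that p y by blast
qed

text \<open>The last step vector is the sum of the others, so \<open>k - 1\<close> vectors span a
  space containing the image of dimension \<open>r\<close>. In the extremal case they span exactly
  that image, where rank one conflicts with invertibility along the walk.\<close>

lemma alternating_walk_length:
  assumes B: "A \<in> SGL n" "B \<in> SGL n"
    and alt: "\<And>\<xi>. \<xi> \<in> bvecs n \<Longrightarrow> dot n \<xi> (sumop n A B \<xi>) = 0"
    and card: "card (sumop n A B ` bvecs n) = 2 ^ r" and r: "r > 0"
    and walk: "gamma_walk n k A B" and C: "invop n (mv n A) C"
  shows "k \<ge> r + 1"
    and "rank_one_on (sumop n A B ` bvecs n) (\<lambda>u v. dot n u (C v)) \<Longrightarrow> k \<noteq> r + 1"
proof -
  define S where "S = sumop n A B"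
  define U where "U = S ` bvecs n"
  have S: "symop n S" unfolding S_def by (rule symop_sumop[OF B])
  obtain p y where p: "p k = B" "\<And>i. i \<le> k \<Longrightarrow> p i \<in> SGL n" and y: "\<And>i. i < k \<Longrightarrow> y i \<in> bvecs n"
    and py: "\<And>i v. i \<le> k \<Longrightarrow> mv n (p i) v = mv n A v + (\<Sum>j<i. scal (dot n (y j) v) (y j))"
    using gamma_walk_steps[OF walk] by blast
  have Sv: "S v = (\<Sum>j<k. scal (dot n (y j) v) (y j))" for v
    using py[of k v] p(1) by (simp add: S_def sumop_def)
  have sum0: "(\<Sum>i<k. y i) = 0"
    using alt Sv by (intro alternating_sum_eq_0[OF y]) (auto simp: S_def)
  have "k \<noteq> 0"
  proof
    assume "k = 0"
    then have "S v = 0" for v using Sv[of v] by (simp flip: zero_fun_def)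
    then have "U \<subseteq> {0}" by (auto simp: U_def)
    then have "card U \<le> 1" using card_mono[of "{0}" U] by simp
    moreover have "(2::nat) ^ 1 \<le> 2 ^ r" using r by (intro power_increasing) auto
    ultimately show False using card by (simp add: U_def S_def)
  qed
  then obtain m where m: "k = Suc m" by (cases k) auto
  have ym: "y m = (\<Sum>i<m. y i)" using sum0 m by (simp add: add.commute vec_add_eq_0_iff)
  have sub: "U \<subseteq> lincomb_bits m y ` bvecs m"
    unfolding U_def Sv m sum_outer_lincomb[OF ym] by (auto simp: bvecs_def)
  have fin: "finite (lincomb_bits m y ` bvecs m)" using subspD(1)[OF subsp_bvecs] by blast
  have le: "card (lincomb_bits m y ` bvecs m) \<le> 2 ^ m"
    using card_image_le[OF subspD(1)[OF subsp_bvecs], of "lincomb_bits m y" m] by (simp add: card_bvecs)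
  have cU: "card U = 2 ^ r" using card by (simp add: U_def S_def)
  then have "(2::nat) ^ r \<le> 2 ^ m" using card_mono[OF fin sub] le by linarith
  then have "r \<le> m" by simp
  then show "k \<ge> r + 1" using m by simp
  define a where "a = (\<lambda>u v. dot n u (C v))"
  assume rank1: "rank_one_on (sumop n A B ` bvecs n) (\<lambda>u v. dot n u (C v))"
  show "k \<noteq> r + 1"
  proof
    assume k: "k = r + 1"
    have r1: "rank_one_on U a" using rank1 by (simp add: U_def S_def a_def)
    have "m = r" using k m by simp
    then have Ueq: "U = lincomb_bits m y ` bvecs m"
      using card_seteq[OF fin sub] le cU by simp
    have yU: "y i \<in> U" if "i < k" for i
    proof (cases "i < m")
      case True
      then show ?thesis unfolding Ueq using lincomb_unit[OF True, of y] unit_bvecs[OF True] by (metis imageI)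
    next
      case False
      have "lincomb_bits m y (\<lambda>i. of_bool (i < m)) = y m"
        unfolding ym lincomb_bits_def by (rule sum.cong) auto
      moreover have "(\<lambda>i. of_bool (i < m)) \<in> bvecs m" by (auto simp: bvecs_def)
      ultimately have "y m \<in> U" unfolding Ueq by (metis imageI)
      then show ?thesis using False that m by (simp add: less_Suc_eq)
    qed
    have y0: "a (y i) (y i) = 0" if "i < k" for i
      using that
    proof (induction i rule: less_induct)
      case (less i)
      show ?case
      proof (rule ccontr)
        assume "a (y i) (y i) \<noteq> 0"
        then have yi: "a (y i) (y i) = 1" by simp
        have iV: "y i \<in> bvecs n" using y less.prems by blast
        \<comment> \<open>At the first \<open>i\<close> where the diagonal of \<open>a\<close> is 1,
          the earlier step vectors pair to zero with \<open>C (y i)\<close>, so the steps up to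
          \<open>i\<close> contribute just \<open>y i\<close>. This cancels
          \<open>A (C (y i)) = y i\<close>, and the matrix reached would be singular.\<close>
        have aj: "dot n (y j) (C (y i)) = a (y j) (y j)" if "j \<le> i" for j
          using rank_one_onD[OF r1 yU yU, of j i] that less.prems yi by (simp add: a_def)
        have "(\<Sum>j<Suc i. scal (dot n (y j) (C (y i))) (y j)) = (\<Sum>j<Suc i. if j = i then y i else 0)"
          using aj less yi by (intro sum.cong) auto
        also have "\<dots> = y i" by simp
        finally have "mv n (p (Suc i)) (C (y i)) = 0"
          using py[of "Suc i" "C (y i)"] less.prems invopD(3)[OF C iV] by simp
        moreover obtain D where "invop n (mv n (p (Suc i))) D"
          using SGL_obtain_inverse p(2)[of "Suc i"] less.prems by (metis Suc_leI)
        ultimately have "C (y i) = 0"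
          using invopD(4) invopD(2)[OF C iV] symop_zero[OF invop_symop_inverse] by metis
        then show False using yi by (simp add: a_def)
      qed
    qed
    obtain u where u: "u \<in> U" "a u u = 1" using r1 unfolding rank_one_on_def by blast
    obtain c where c: "u = lincomb_bits m y c" using u Ueq by blast
    have "lin_on (bvecs n) (\<lambda>u. a u u)"
      unfolding a_def by (rule sym_form_diag[OF subsp_bvecs invop_form[OF C]]) simp
    then have "a u u = (\<Sum>i<m. c i * a (y i) (y i))"
      unfolding c using lin_on_lincomb[of n "\<lambda>u. a u u" m y c] y m by simp
    also have "\<dots> = 0" using y0 m by simp
    finally show False using u by simp
  qed
qed

lemma gamma_dist_eqI:
  assumes "gamma_walk n k A B" "\<And>j. gamma_walk n j A B \<Longrightarrow> k \<le> j"
  shows "gamma_dist n A B = enat k"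
  unfolding gamma_dist_def
  by (rule antisym) (use assms in \<open>auto intro!: INF_lower2[of k] INF_greatest\<close>)

section \<open>Gram matrices and the distance\<close>

text \<open>The defect \<open>q\<close> is additive in each argument and the diagonal is linear, so
  both conditions pass between generators and span.\<close>

lemma rank_one_on_lincomb_iff:
  assumes y: "\<And>i. i < r \<Longrightarrow> y i \<in> bvecs n" and a: "sym_form (bvecs n) a"
  shows "rank_one_on (lincomb_bits r y ` bvecs r) a \<longleftrightarrow>
    (\<forall>i<r. \<forall>j<r. a (y i) (y j) = a (y i) (y i) * a (y j) (y j)) \<and> (\<exists>i<r. a (y i) (y i) = 1)"
    (is "?L \<longleftrightarrow> ?P \<and> ?Q")
proof
  assume L: ?L
  have yU: "y i \<in> lincomb_bits r y ` bvecs r" if "i < r" for i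
    using lincomb_unit[OF that, of y] unit_bvecs[OF that] by (metis imageI)
  have ?P by (intro allI impI rank_one_onD[OF L yU yU])
  moreover have ?Q
  proof (rule ccontr)
    assume neg: "\<not> ?Q"
    obtain c where c: "a (lincomb_bits r y c) (lincomb_bits r y c) = 1"
      using L unfolding rank_one_on_def by blast
    have "a (lincomb_bits r y c) (lincomb_bits r y c) = (\<Sum>i<r. c i * a (y i) (y i))"
      using lin_on_lincomb[OF sym_form_diag[OF subsp_bvecs a] y] .
    also have "\<dots> = 0" using neg by (intro sum.neutral) auto
    finally show False using c by simp
  qed
  ultimately show "?P \<and> ?Q" ..
next
  assume PQ: "?P \<and> ?Q"
  define q where "q u v = a u v + a u u * a v v" for u v
  have lq: "lin_on (bvecs n) (q u)" if "u \<in> bvecs n" for u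
    unfolding q_def by (intro lin_on_add lin_on_mult sym_formD(1)[OF a that] sym_form_diag[OF subsp_bvecs a])
  have qs: "q u v = q v u" if "u \<in> bvecs n" "v \<in> bvecs n" for u v
    using sym_formD(2)[OF a that] by (simp add: q_def mult.commute)
  have q0: "q (y i) (y j) = 0" if "i < r" "j < r" for i j
  proof -
    have "a (y i) (y j) = a (y i) (y i) * a (y j) (y j)" using PQ that by blast
    then show ?thesis unfolding q_def by (simp only: bit_add_eq_0_iff)
  qed
  have LV: "lincomb_bits r y c \<in> bvecs n" for c by (rule lincomb_bits_closed[OF y])
  have q1: "q (y i) (lincomb_bits r y d) = 0" if "i < r" for i d
    using lin_on_lincomb[OF lq[OF y[OF that]] y] q0[OF that] by simp
  have q2: "q (lincomb_bits r y c) (lincomb_bits r y d) = 0" for c d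
    using lin_on_lincomb[OF lq[OF LV] y] q1 qs[OF LV y] by simp
  have "a u v = a u u * a v v" if "u \<in> lincomb_bits r y ` bvecs r" "v \<in> lincomb_bits r y ` bvecs r" for u v
  proof -
    have "q u v = 0" using q2 that by blast
    then show ?thesis unfolding q_def by (simp only: bit_add_eq_0_iff)
  qed
  moreover obtain i where "i < r" "a (y i) (y i) = 1" using PQ by blast
  moreover have "y i \<in> lincomb_bits r y ` bvecs r"
    using lincomb_unit[OF \<open>i < r\<close>, of y] unit_bvecs[OF \<open>i < r\<close>] by (metis imageI)
  ultimately show ?L unfolding rank_one_on_def by blast
qed

text \<open>The additional vector lies in the span, and its diagonal value is the sum of the others,
  so it cannot be the only one with value 1.\<close>

lemma rank_one_on_lincomb_Suc_iff:
  assumes y: "\<And>i. i < r \<Longrightarrow> y i \<in> bvecs n" and yr: "y r = (\<Sum>i<r. y i)" and a: "sym_form (bvecs n) a"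
  shows "rank_one_on (lincomb_bits r y ` bvecs r) a \<longleftrightarrow>
    (\<forall>i<Suc r. \<forall>j<Suc r. a (y i) (y j) = a (y i) (y i) * a (y j) (y j)) \<and> (\<exists>i<Suc r. a (y i) (y i) = 1)"
    (is "?L \<longleftrightarrow> ?P \<and> ?Q")
proof
  assume L: ?L
  have "y i \<in> lincomb_bits r y ` bvecs r" if "i < Suc r" for i
  proof (cases "i < r")
    case True
    then show ?thesis using lincomb_unit[OF True, of y] unit_bvecs[OF True] by (metis imageI)
  next
    case False
    have "lincomb_bits r y (\<lambda>i. of_bool (i < r)) = y r"
      unfolding yr lincomb_bits_def by (rule sum.cong) auto
    moreover have "(\<lambda>i. of_bool (i < r)) \<in> bvecs r" by (auto simp: bvecs_def)
    ultimately have "y r \<in> lincomb_bits r y ` bvecs r" by (metis imageI)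
    then show ?thesis using False that by (simp add: less_Suc_eq)
  qed
  then have ?P by (intro allI impI rank_one_onD[OF L])
  moreover have "\<exists>i<r. a (y i) (y i) = 1" using L rank_one_on_lincomb_iff[of r y n a, OF y a] by blast
  ultimately show "?P \<and> ?Q" using less_SucI by blast
next
  assume PQ: "?P \<and> ?Q"
  have "\<exists>i<r. a (y i) (y i) = 1"
  proof (rule ccontr)
    assume neg: "\<not> ?thesis"
    obtain i where "i < Suc r" "a (y i) (y i) = 1" using PQ by blast
    then have "a (y r) (y r) = 1" using neg less_Suc_eq by metis
    moreover have "a (y r) (y r) = (\<Sum>i<r. a (y i) (y i))"
      unfolding yr by (rule lin_on_sum[OF sym_form_diag[OF subsp_bvecs a], of r y, OF y])
    moreover have "\<dots> = 0" using neg by (intro sum.neutral) auto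
    ultimately show False by simp
  qed
  moreover have "\<forall>i<r. \<forall>j<r. a (y i) (y j) = a (y i) (y i) * a (y j) (y j)"
    using PQ less_SucI by blast
  ultimately show ?L using rank_one_on_lincomb_iff[of r y n a, OF y a] by blast
qed

theorem theorem2p3:
  fixes n r :: nat and A B Ainv :: "bit mat" and x :: "nat \<Rightarrow> bit vec"
  assumes "n \<ge> 1"
    and "A \<in> SGL n" and "B \<in> SGL n"
    and "Ainv \<in> carrier_mat n n" and "inverts_mat A Ainv" and "inverts_mat Ainv A"
    and "r > 0" and "even r"
    and "\<forall>i\<le>r. x i \<in> carrier_vec n"
    and "lin_indep_vecs n r x"
    and "x r = vec n (\<lambda>j. \<Sum>i<r. x i $ j)"
    and "\<forall>a<n. \<forall>b<n. (B - A) $$ (a, b) = (\<Sum>i<r+1. x i $ a * x i $ b)"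
  shows "(vec_space.rank (r+1) (mat (r+1) (r+1) (\<lambda>(i,j). x i \<bullet> (Ainv *\<^sub>v x j))) \<noteq> 1
            \<longrightarrow> gamma_dist n A B = enat (r+1))
       \<and> (vec_space.rank (r+1) (mat (r+1) (r+1) (\<lambda>(i,j). x i \<bullet> (Ainv *\<^sub>v x j))) = 1
            \<longrightarrow> gamma_dist n A B = enat (r+2))"
proof -
  note A = assms(2) and B = assms(3) and xc = assms(9)
  define C where "C = mv n Ainv"
  have C: "invop n (mv n A) C" unfolding C_def by (rule invop_mv[OF A assms(4-6)])
  have cA: "A \<in> carrier_mat n n" and cB: "B \<in> carrier_mat n n" using SGL_D A B by auto
  define y where "y i = (\<lambda>j. if j < n then x i $ j else 0)" for i
  have yV: "y i \<in> bvecs n" for i by (simp add: y_def bvecs_def)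
  have vy: "vec n (y i) = x i" if "i \<le> r" for i
    using xc that by (intro eq_vecI) (auto simp: y_def)
  have yr: "y r = (\<Sum>i<r. y i)"
    using assms(11) by (auto simp: fun_eq_iff sum_fun_apply y_def)
  define a where "a = (\<lambda>u v. dot n u (C v))"
  have aV: "sym_form (bvecs n) a" unfolding a_def by (rule invop_form[OF C]) simp
  have ind: "c = 0" if c: "c \<in> bvecs r" "lincomb_bits r y c = 0" for c
  proof -
    have "(\<Sum>i<r. c i * x i $ j) = 0" if "j < n" for j
    proof -
      have "lincomb_bits r y c j = 0" using c(2) by simp
      then show ?thesis using that by (simp add: lincomb_bits_def sum_fun_apply scal_def y_def)
    qed
    then have "\<forall>i<r. c i = 0" using assms(10) unfolding lin_indep_vecs_def by blast
    then show ?thesis using c(1) by (auto simp: fun_eq_iff bvecs_def) (metis not_le)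
  qed
  have Sv: "sumop n A B v = (\<Sum>i<Suc r. scal (dot n (y i) v) (y i))" for v
  proof
    fix k
    show "sumop n A B v k = (\<Sum>i<Suc r. scal (dot n (y i) v) (y i)) k"
    proof (cases "k < n")
      case True
      have AB: "A $$ (k, b) + B $$ (k, b) = (\<Sum>i<Suc r. y i k * y i b)" if "b < n" for b
      proof -
        have "A $$ (k, b) + B $$ (k, b) = (B - A) $$ (k, b)"
          using True that cA cB by (simp add: add.commute)
        also have "\<dots> = (\<Sum>i<r+1. x i $ k * x i $ b)" using assms(12) True that by blast
        finally show ?thesis using True that by (simp add: y_def)
      qed
      have "sumop n A B v k = (\<Sum>b<n. (A $$ (k, b) + B $$ (k, b)) * v b)"
        using True by (simp add: sumop_def mv_def distrib_right sum.distrib)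
      also have "\<dots> = (\<Sum>b<n. (\<Sum>i<Suc r. y i k * y i b) * v b)"
        by (rule sum.cong[OF refl]) (simp only: AB lessThan_iff)
      also have "\<dots> = (\<Sum>b<n. \<Sum>i<Suc r. y i b * v b * y i k)"
        by (simp only: sum_distrib_left sum_distrib_right mult_ac)
      also have "\<dots> = (\<Sum>i<Suc r. \<Sum>b<n. y i b * v b * y i k)" by (rule sum.swap)
      also have "\<dots> = (\<Sum>i<Suc r. scal (dot n (y i) v) (y i)) k"
        by (simp only: sum_fun_apply scal_def dot_def sum_distrib_right)
      finally show ?thesis .
    next
      case False
      then show ?thesis by (simp add: sumop_def mv_def sum_fun_apply scal_def y_def)
    qed
  qed
  have ysum: "(\<Sum>i<Suc r. y i) = 0" unfolding sum.lessThan_Suc yr by (rule vec_add_self)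
  \<comment> \<open>The squares \<open>(dot n (y i) v)^2\<close> reduce to
    \<open>dot n (y i) v\<close>, and the vectors \<open>y i\<close> sum to zero.\<close>
  have alt: "dot n v (sumop n A B v) = 0" for v
  proof -
    have "dot n v (sumop n A B v) = (\<Sum>i<Suc r. dot n (y i) v)"
      unfolding Sv dot_sum_right by (simp only: dot_scal dot_commute[of n v] bit_mult_self)
    also have "\<dots> = dot n (\<Sum>i<Suc r. y i) v" by (simp only: dot_sum_left)
    finally show ?thesis unfolding ysum by simp
  qed
  have im: "sumop n A B ` bvecs n = lincomb_bits r y ` bvecs r"
    using image_alternating_sum[of r y n, OF yV yr assms(8) ind] unfolding Sv .
  have card: "card (sumop n A B ` bvecs n) = 2 ^ r"
    unfolding im by (rule card_lincomb_image[OF ind])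
  define G where "G = mat (r+1) (r+1) (\<lambda>(i,j). x i \<bullet> (Ainv *\<^sub>v x j))"
  have G: "G $$ (i, j) = a (y i) (y j)" if "i < r + 1" "j < r + 1" for i j
  proof -
    have "x i \<bullet> (Ainv *\<^sub>v x j) = vec n (y i) \<bullet> vec n (C (y j))"
      using that assms(4) by (simp add: vy C_def vec_mv)
    also have "\<dots> = a (y i) (y j)" by (simp add: a_def dot_def scalar_prod_def atLeast0LessThan)
    finally show ?thesis using that by (simp add: G_def)
  qed
  have "vec_space.rank (r+1) G = 1 \<longleftrightarrow>
    (\<forall>i<r+1. \<forall>j<r+1. G $$ (i, j) = G $$ (i, i) * G $$ (j, j)) \<and> (\<exists>i<r+1. G $$ (i, i) = 1)"
  proof (rule rank_one_symmetric_bit_iff)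
    show "G $$ (i, j) = G $$ (j, i)" if "i < r + 1" "j < r + 1" for i j
      using G that sym_formD(2)[OF aV yV yV] by simp
  qed (simp add: G_def)
  also have "\<dots> \<longleftrightarrow> (\<forall>i<Suc r. \<forall>j<Suc r. a (y i) (y j) = a (y i) (y i) * a (y j) (y j)) \<and>
      (\<exists>i<Suc r. a (y i) (y i) = 1)"
  proof (rule arg_cong2[where f="(\<and>)"])
    show "(\<forall>i<r+1. \<forall>j<r+1. G $$ (i, j) = G $$ (i, i) * G $$ (j, j)) \<longleftrightarrow>
      (\<forall>i<Suc r. \<forall>j<Suc r. a (y i) (y j) = a (y i) (y i) * a (y j) (y j))"
      by (simp only: Suc_eq_plus1 G cong: imp_cong)
    show "(\<exists>i<r+1. G $$ (i, i) = 1) \<longleftrightarrow> (\<exists>i<Suc r. a (y i) (y i) = 1)"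
      by (simp only: Suc_eq_plus1 G cong: conj_cong)
  qed
  also have "\<dots> \<longleftrightarrow> rank_one_on (sumop n A B ` bvecs n) a"
    unfolding im by (rule rank_one_on_lincomb_Suc_iff[of r y n a, OF yV yr aV, symmetric])
  finally have rank: "vec_space.rank (r+1) G = 1 \<longleftrightarrow>
    rank_one_on (sumop n A B ` bvecs n) (\<lambda>u v. dot n u (C v))"
    unfolding a_def .
  note length = alternating_walk_length[OF A B alt card assms(7) _ C]
  have "gamma_dist n A B = enat (r + 1)" if "vec_space.rank (r+1) G \<noteq> 1"
  proof (rule gamma_dist_eqI)
    show "gamma_walk n (r + 1) A B"
      using alternating_walk[OF A B C alt card assms(8,7)] that rank by blast
  qed (rule length(1))
  moreover have "gamma_dist n A B = enat (r + 2)" if "vec_space.rank (r+1) G = 1"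
  proof (rule gamma_dist_eqI)
    have "r \<ge> 2" using assms(7,8) by (auto elim!: evenE)
    then show "gamma_walk n (r + 2) A B"
      using alternating_walk_rank_one[OF A B C alt card] that rank by blast
    \<comment> \<open>The general bound gives \<open>r + 1 \<le> j\<close>, and rank one rules out
      equality.\<close>
    show "r + 2 \<le> j" if "gamma_walk n j A B" for j
      using length(1)[OF that] length(2)[OF that] rank \<open>vec_space.rank (r+1) G = 1\<close> by linarith
  qed
  ultimately show ?thesis unfolding G_def by blast
qed

end
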